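(* Let $k$ be a perfect field of characteristic $p>0$, $P$ a finite poset, $R=\mathcal{R}_k[J(P)]$ the Hibi ring and $\mathfrak{m}=R_+$. Then \[ \operatorname{fpt}(\mathfrak{m})=\operatorname{rank}_*\overline{P}=\operatorname{rank}_*P+2 . \] In particular $\operatorname{fpt}(\mathfrak{m})\in\mathbb{N}$.
   Context: Let $P=\{p_1,\dots,p_N\}$ be a finite poset and $J(P)$ the set of poset ideals of $P$ (down-closed subsets, including $\emptyset$ and $P$). The Hibi ring is $\mathcal{R}_k[J(P)]=k[\,T\prod_{p_i\in I}X_i\mid I\in J(P)\,]\subseteq k[T,X_1,\dots,X_N]$, each generator in degree $1$; $\mathfrak{m}=R_+$ is generated by these generators. $\overline{P}=P\cup\{-\infty,\infty\}$ with $-\infty<x<\infty$ for all $x\in P$. $F$-pure threshold: for a real $t\ge0$, the pair $(R,\mathfrak{m}^t)$ is $F$-pure if for all large $q=p^e$ there is $d\in\mathfrak{m}^{\lceil t(q-1)\rceil}$ such that the $R$-linear map $R\to R^{1/q}$, $1\mapsto d^{1/q}$, splits; $\operatorname{fpt}(\mathfrak{m})=\sup\{t\ge0\mid(R,\mathfrak{m}^t)\text{ is }F\text{-pure}\}$. For a finite poset $Q$ (applied to $Q=P$ and $Q=\overline{P}$): $x\lessdot y$ means $x<y$ with no $z$ satisfying $x<z<y$. A path is a sequence $C=(q_1,\dots,q_t)$ of distinct elements of $Q$ with $q_1$ minimal in $Q$, consecutive elements related by $q_i\lessdot q_{i+1}$ or $q_{i+1}\lessdot q_i$, and $q_{t-1}\lessdot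 q_t$ (when $t\ge2$); it is maximal if $q_t$ is maximal in $Q$. For $1<i<t$, $q_i$ is locally maximal if $q_{i-1}\lessdot q_i$ and $q_{i+1}\lessdot q_i$, locally minimal if $q_i\lessdot q_{i-1}$ and $q_i\lessdot q_{i+1}$; $q_1$ counts as locally minimal and $q_t$ as locally maximal. The decomposition $C=A_1+D_1+\cdots+D_{n-1}+A_n$ splits $C$ into consecutive blocks: $A_1$ is $q_1$ through the first locally maximal element, $D_1$ the following elements through the next locally minimal element, $A_2$ the following elements through the next locally maximal element, etc., $A_n$ ending at $q_t$; $t(A_i)$ is the last element of $A_i$, $V(\cdot)$ the set of elements of a block, $\langle A\rangle=\{q\in Q\mid q\le t(A)\}$, and $\langle A_i\setminus t(A_i)\rangle$ the poset ideal generated by the elements of $A_i$ other than $t(A_i)$. $C$ satisfies ( * ) if for all $1\le i\le n-1$: (1) $V(D_i)\cap(\bigcup_{m=1}^{i-1}\langle A_m\rangle\cup\langle A_i\setminus t(A_i)\rangle\cup\{t(A_i)\})=\emptyset$; (2) $V(A_{i+1})\cap\bigcup_{m=1}^{i}\langle A_m\rangle=\emptyset$. $\operatorname{len}^*C=\#\{i\mid q_i\lessdot q_{i+1}\}$, and the lower rank $\operatorname{rank}_*Q$ is the minimum of $\operatorname{len}^*C$ over maximal paths $C$ of $Q$ satisfying ( * ). *)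

theory Defs
  imports Complex_Main "HOL-Library.Poly_Mapping"
begin

definition partial_order_on_set :: "'a set \<Rightarrow> ('a \<Rightarrow> 'a \<Rightarrow> bool) \<Rightarrow> bool" where
  "partial_order_on_set Q le \<longleftrightarrow>
     (\<forall>x\<in>Q. le x x) \<and>
     (\<forall>x\<in>Q. \<forall>y\<in>Q. le x y \<and> le y x \<longrightarrow> x = y) \<and>
     (\<forall>x\<in>Q. \<forall>y\<in>Q. \<forall>z\<in>Q. le x y \<and> le y z \<longrightarrow> le x z)"

definition poset_ideals :: "'a set \<Rightarrow> ('a \<Rightarrow> 'a \<Rightarrow> bool) \<Rightarrow> 'a set set" where
  "poset_ideals P le = {I. I \<subseteq> P \<and> (\<forall>x\<in>I. \<forall>y\<in>P. le y x \<longrightarrow> y \<in> I)}"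

datatype 'a ext = NegInf | Fin 'a | PosInf

definition ext_carrier :: "'a set \<Rightarrow> 'a ext set" where
  "ext_carrier P = {NegInf, PosInf} \<union> Fin ` P"

fun ext_le :: "('a \<Rightarrow> 'a \<Rightarrow> bool) \<Rightarrow> 'a ext \<Rightarrow> 'a ext \<Rightarrow> bool" where
  "ext_le le NegInf y = True"
| "ext_le le (Fin x) NegInf = False"
| "ext_le le (Fin x) (Fin y) = le x y"
| "ext_le le (Fin x) PosInf = True"
| "ext_le le PosInf y = (y = PosInf)"

definition lt_in :: "('b \<Rightarrow> 'b \<Rightarrow> bool) \<Rightarrow> 'b \<Rightarrow> 'b \<Rightarrow> bool" where
  "lt_in le x y \<longleftrightarrow> le x y \<and> x \<noteq> y"

definition covers :: "'b set \<Rightarrow> ('b \<Rightarrow> 'b \<Rightarrow> bool) \<Rightarrow> 'b \<Rightarrow> 'b \<Rightarrow> bool" where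
  "covers Q le x y \<longleftrightarrow> x \<in> Q \<and> y \<in> Q \<and> lt_in le x y \<and>
      \<not> (\<exists>z\<in>Q. lt_in le x z \<and> lt_in le z y)"

definition is_minimal :: "'b set \<Rightarrow> ('b \<Rightarrow> 'b \<Rightarrow> bool) \<Rightarrow> 'b \<Rightarrow> bool" where
  "is_minimal Q le x \<longleftrightarrow> x \<in> Q \<and> \<not> (\<exists>y\<in>Q. lt_in le y x)"

definition is_maximal :: "'b set \<Rightarrow> ('b \<Rightarrow> 'b \<Rightarrow> bool) \<Rightarrow> 'b \<Rightarrow> bool" where
  "is_maximal Q le x \<longleftrightarrow> x \<in> Q \<and> \<not> (\<exists>y\<in>Q. lt_in le x y)"

definition is_path :: "'b set \<Rightarrow> ('b \<Rightarrow> 'b \<Rightarrow> bool) \<Rightarrow> 'b list \<Rightarrow> bool" where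
  "is_path Q le C \<longleftrightarrow> C \<noteq> [] \<and> distinct C \<and> set C \<subseteq> Q \<and>
     is_minimal Q le (C ! 0) \<and>
     (\<forall>i. Suc i < length C \<longrightarrow>
        covers Q le (C ! i) (C ! Suc i) \<or> covers Q le (C ! Suc i) (C ! i)) \<and>
     (2 \<le> length C \<longrightarrow> covers Q le (C ! (length C - 2)) (C ! (length C - 1)))"

definition is_maximal_path :: "'b set \<Rightarrow> ('b \<Rightarrow> 'b \<Rightarrow> bool) \<Rightarrow> 'b list \<Rightarrow> bool" where
  "is_maximal_path Q le C \<longleftrightarrow> is_path Q le C \<and> is_maximal Q le (last C)"

definition loc_max :: "'b set \<Rightarrow> ('b \<Rightarrow> 'b \<Rightarrow> bool) \<Rightarrow> 'b list \<Rightarrow> nat \<Rightarrow> bool" where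
  "loc_max Q le C i \<longleftrightarrow> i < length C \<and>
     (i = length C - 1 \<or>
      (0 < i \<and> covers Q le (C ! (i - 1)) (C ! i) \<and> covers Q le (C ! Suc i) (C ! i)))"

definition loc_min :: "'b set \<Rightarrow> ('b \<Rightarrow> 'b \<Rightarrow> bool) \<Rightarrow> 'b list \<Rightarrow> nat \<Rightarrow> bool" where
  "loc_min Q le C i \<longleftrightarrow> i < length C \<and>
     (i = 0 \<or>
      (Suc i < length C \<and> covers Q le (C ! i) (C ! (i - 1)) \<and> covers Q le (C ! i) (C ! Suc i)))"

text \<open>Sorted lists of positions of locally maximal / minimal elements.
  With lmax = [a_0,...,a_(n-1)] and lmin = [b_0 = 0, b_1, ..., b_(n-1)], the decomposition
  C = A_1 + D_1 + ... + D_(n-1) + A_n is (0-indexed blocks):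
  A_0 = positions 0..a_0, A_i = positions b_i+1..a_i (i \<ge> 1),
  D_i = positions a_i+1..b_(i+1) (i < n-1).\<close>
definition lmax_pos :: "'b set \<Rightarrow> ('b \<Rightarrow> 'b \<Rightarrow> bool) \<Rightarrow> 'b list \<Rightarrow> nat list" where
  "lmax_pos Q le C = sorted_list_of_set {i. loc_max Q le C i}"

definition lmin_pos :: "'b set \<Rightarrow> ('b \<Rightarrow> 'b \<Rightarrow> bool) \<Rightarrow> 'b list \<Rightarrow> nat list" where
  "lmin_pos Q le C = sorted_list_of_set {i. loc_min Q le C i}"

definition num_blocks :: "'b set \<Rightarrow> ('b \<Rightarrow> 'b \<Rightarrow> bool) \<Rightarrow> 'b list \<Rightarrow> nat" where
  "num_blocks Q le C = length (lmax_pos Q le C)"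

definition A_pos :: "'b set \<Rightarrow> ('b \<Rightarrow> 'b \<Rightarrow> bool) \<Rightarrow> 'b list \<Rightarrow> nat \<Rightarrow> nat set" where
  "A_pos Q le C i =
     {(if i = 0 then 0 else Suc (lmin_pos Q le C ! i)) .. lmax_pos Q le C ! i}"

definition D_pos :: "'b set \<Rightarrow> ('b \<Rightarrow> 'b \<Rightarrow> bool) \<Rightarrow> 'b list \<Rightarrow> nat \<Rightarrow> nat set" where
  "D_pos Q le C i = {Suc (lmax_pos Q le C ! i) .. lmin_pos Q le C ! Suc i}"

definition tA :: "'b set \<Rightarrow> ('b \<Rightarrow> 'b \<Rightarrow> bool) \<Rightarrow> 'b list \<Rightarrow> nat \<Rightarrow> 'b" where
  "tA Q le C i = C ! (lmax_pos Q le C ! i)"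

definition gen_A :: "'b set \<Rightarrow> ('b \<Rightarrow> 'b \<Rightarrow> bool) \<Rightarrow> 'b list \<Rightarrow> nat \<Rightarrow> 'b set" where
  "gen_A Q le C i = {q \<in> Q. le q (tA Q le C i)}"

definition gen_A_minus :: "'b set \<Rightarrow> ('b \<Rightarrow> 'b \<Rightarrow> bool) \<Rightarrow> 'b list \<Rightarrow> nat \<Rightarrow> 'b set" where
  "gen_A_minus Q le C i =
     {q \<in> Q. \<exists>j \<in> A_pos Q le C i. j \<noteq> lmax_pos Q le C ! i \<and> le q (C ! j)}"

definition star_cond :: "'b set \<Rightarrow> ('b \<Rightarrow> 'b \<Rightarrow> bool) \<Rightarrow> 'b list \<Rightarrow> bool" where
  "star_cond Q le C \<longleftrightarrow>
     (\<forall>i. Suc i < num_blocks Q le C \<longrightarrow>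
        ((\<lambda>j. C ! j) ` D_pos Q le C i \<inter>
           ((\<Union>m<i. gen_A Q le C m) \<union> gen_A_minus Q le C i \<union> {tA Q le C i}) = {}) \<and>
        ((\<lambda>j. C ! j) ` A_pos Q le C (Suc i) \<inter> (\<Union>m\<le>i. gen_A Q le C m) = {}))"

definition len_up :: "'b set \<Rightarrow> ('b \<Rightarrow> 'b \<Rightarrow> bool) \<Rightarrow> 'b list \<Rightarrow> nat" where
  "len_up Q le C = card {i. Suc i < length C \<and> covers Q le (C ! i) (C ! Suc i)}"

definition lower_rank :: "'b set \<Rightarrow> ('b \<Rightarrow> 'b \<Rightarrow> bool) \<Rightarrow> nat" where
  "lower_rank Q le =
     Min {len_up Q le C | C. is_maximal_path Q le C \<and> star_cond Q le C}"

text \<open>The polynomial ring k[T, X_p (p \<in> P)]: variable None is T, variable Some p is X_p.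
  Polynomials are finitely supported maps from monomials (exponent vectors) to k.\<close>
type_synonym ('a, 'k) hpoly = "('a option \<Rightarrow>\<^sub>0 nat) \<Rightarrow>\<^sub>0 'k"

definition hibi_gen :: "'a set \<Rightarrow> ('a, 'k::comm_ring_1) hpoly" where
  "hibi_gen I = Poly_Mapping.single
      (Poly_Mapping.single None 1 + (\<Sum>p\<in>I. Poly_Mapping.single (Some p) 1)) 1"

definition const_poly :: "'k::comm_ring_1 \<Rightarrow> ('a, 'k) hpoly" where
  "const_poly c = Poly_Mapping.single 0 c"

inductive_set hibi_ring :: "'a set \<Rightarrow> ('a \<Rightarrow> 'a \<Rightarrow> bool) \<Rightarrow> ('a, 'k::comm_ring_1) hpoly set"
  for P le where
  const: "const_poly c \<in> hibi_ring P le"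
| gen: "I \<in> poset_ideals P le \<Longrightarrow> hibi_gen I \<in> hibi_ring P le"
| add: "x \<in> hibi_ring P le \<Longrightarrow> y \<in> hibi_ring P le \<Longrightarrow> x + y \<in> hibi_ring P le"
| mult: "x \<in> hibi_ring P le \<Longrightarrow> y \<in> hibi_ring P le \<Longrightarrow> x * y \<in> hibi_ring P le"

text \<open>m^n, where m = R_+ is the ideal of R generated by the generators: the ideal of R
  generated by all products of n generators, i.e. R-linear combinations of such products.\<close>
definition max_ideal_pow :: "'a set \<Rightarrow> ('a \<Rightarrow> 'a \<Rightarrow> bool) \<Rightarrow> nat \<Rightarrow> ('a, 'k::comm_ring_1) hpoly set" where
  "max_ideal_pow P le n =
     {sum_list (map (\<lambda>(r, Is). r * prod_list (map hibi_gen Is)) L) | L.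
        \<forall>(r, Is) \<in> set L. r \<in> hibi_ring P le \<and> length Is = n \<and> set Is \<subseteq> poset_ideals P le}"

text \<open>The R-linear map R \<rightarrow> R^{1/q}, 1 \<mapsto> d^{1/q} splits. We identify R^{1/q} with the
  Frobenius pushforward F^e_* R (s^{1/q} \<leftrightarrow> s, with r \<cdot> s = r^q s); a splitting is an
  R-linear map \<phi> : F^e_* R \<rightarrow> R with \<phi>(d) = 1.\<close>
definition frob_splits :: "'a set \<Rightarrow> ('a \<Rightarrow> 'a \<Rightarrow> bool) \<Rightarrow> nat \<Rightarrow> ('a, 'k::comm_ring_1) hpoly \<Rightarrow> bool" where
  "frob_splits P le q d \<longleftrightarrow>
     (\<exists>\<phi> :: ('a, 'k) hpoly \<Rightarrow> ('a, 'k) hpoly.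
        (\<forall>x\<in>hibi_ring P le. \<phi> x \<in> hibi_ring P le) \<and>
        (\<forall>x\<in>hibi_ring P le. \<forall>y\<in>hibi_ring P le. \<phi> (x + y) = \<phi> x + \<phi> y) \<and>
        (\<forall>r\<in>hibi_ring P le. \<forall>s\<in>hibi_ring P le. \<phi> (r ^ q * s) = r * \<phi> s) \<and>
        \<phi> d = 1)"

definition F_pure_pair :: "'k::field itself \<Rightarrow> 'a set \<Rightarrow> ('a \<Rightarrow> 'a \<Rightarrow> bool) \<Rightarrow> real \<Rightarrow> bool" where
  "F_pure_pair _ P le t \<longleftrightarrow>
     (\<exists>e0. \<forall>e\<ge>e0.
        \<exists>d :: ('a, 'k) hpoly.
          d \<in> max_ideal_pow P le (nat \<lceil>t * (real (CHAR('k) ^ e) - 1)\<rceil>) \<and>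
          frob_splits P le (CHAR('k) ^ e) d)"

definition fpt_max :: "'k::field itself \<Rightarrow> 'a set \<Rightarrow> ('a \<Rightarrow> 'a \<Rightarrow> bool) \<Rightarrow> real" where
  "fpt_max k P le = Sup {t. 0 \<le> t \<and> F_pure_pair k P le t}"

definition perfect_field :: "'k::field itself \<Rightarrow> bool" where
  "perfect_field _ \<longleftrightarrow> (\<forall>x::'k. \<exists>y. y ^ CHAR('k) = x)"

end

theory Submission
  imports Defs "HOL-Computational_Algebra.Primes"
begin

text \<open>
  Exponents of monomials of the Hibi ring are the order-reversing functions on the extended poset
  that vanish at the top, the value at the bottom being the degree; the facets of their cone are the
  covers. Sending 1 to the \<open>q\<close>-th root of a monomial splits exactly if every cover has slope at most
  \<open>q - 1\<close>, so the threshold is the largest value at the bottom of a function whose slopes lie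
  between 0 and 1. By shortest-path duality this is the least cost of a walk from bottom to top in
  which an upward step costs 1 and a downward step costs 0. A cheapest path automatically satisfies
  the star condition, because a path violating it could be shortened inside an ideal it has already
  climbed; hence the least cost is the lower rank.
\<close>

text \<open>The obstacle in the upper bound is that a splitting \<open>\<phi>\<close> is an
  arbitrary linear map, not compatible with the grading. Only the constant term of
  \<open>\<phi> d = 1\<close> is used: some monomial of \<open>d\<close> must have an image with
  non-zero constant term. If that monomial had slope at least q on a facet, multiplying it by the
  q-th power of a monomial x^g of slope 0 there would make it divisible in the ring by the q-th
  power of some x^w of slope 1. Pulling both powers out of \<open>\<phi>\<close> makes x^g a term of
  x^w times a ring element, which the slopes forbid. For the lower bound the splitting is explicit,
  and perfectness supplies additive q-th roots of the coefficients. Nothing is lost to rounding. The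
  optimal function is the total cost minus the distance from the bottom, hence integral; its
  multiple by q - 1 is the exponent of one monomial, of degree exactly q - 1 times the least cost.
  So the threshold is attained and is an integer.\<close>

section \<open>Walks and the lower rank\<close>

text \<open>The index is the exact number of upward steps, not the length. Vertices may repeat, so
  walks can be extended and joined without checking distinctness.\<close>

inductive reach :: "'b set \<Rightarrow> ('b \<Rightarrow> 'b \<Rightarrow> bool) \<Rightarrow> nat \<Rightarrow> 'b \<Rightarrow> bool" for Q le where
  reach_minimal: "is_minimal Q le x \<Longrightarrow> reach Q le 0 x"
| reach_up: "reach Q le n x \<Longrightarrow> covers Q le x y \<Longrightarrow> reach Q le (Suc n) y"
| reach_down: "reach Q le n y \<Longrightarrow> covers Q le x y \<Longrightarrow> reach Q le n x"

definition ups :: "'b set \<Rightarrow> ('b \<Rightarrow> 'b \<Rightarrow> bool) \<Rightarrow> 'b list \<Rightarrow> nat \<Rightarrow> nat" where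
  "ups Q le C k = card {i. i < k \<and> covers Q le (C ! i) (C ! Suc i)}"

text \<open>This is \<open>is_path\<close> without the demand that the last step goes up, which
  neither prefixes nor extensions by a downward step would preserve.\<close>

definition is_walk :: "'b set \<Rightarrow> ('b \<Rightarrow> 'b \<Rightarrow> bool) \<Rightarrow> 'b list \<Rightarrow> bool" where
  "is_walk Q le C \<longleftrightarrow> C \<noteq> [] \<and> distinct C \<and> set C \<subseteq> Q \<and> is_minimal Q le (C ! 0) \<and>
     (\<forall>i. Suc i < length C \<longrightarrow>
        covers Q le (C ! i) (C ! Suc i) \<or> covers Q le (C ! Suc i) (C ! i))"

lemma ups_0 [simp]: "ups Q le C 0 = 0"
  by (simp add: ups_def)

lemma ups_Suc: "ups Q le C (Suc k) = ups Q le C k + (if covers Q le (C ! k) (C ! Suc k) then 1 else 0)"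
proof -
  have "{i. i < Suc k \<and> covers Q le (C ! i) (C ! Suc i)} =
     (if covers Q le (C ! k) (C ! Suc k) then insert k {i. i < k \<and> covers Q le (C ! i) (C ! Suc i)}
      else {i. i < k \<and> covers Q le (C ! i) (C ! Suc i)})"
    by (auto simp: less_Suc_eq)
  then show ?thesis by (auto simp: ups_def)
qed

lemma ups_mono: "i \<le> j \<Longrightarrow> ups Q le C i \<le> ups Q le C j"
  by (induction j rule: dec_induct) (auto simp: ups_Suc)

lemma ups_less: "i \<le> k \<Longrightarrow> k < j \<Longrightarrow> covers Q le (C ! k) (C ! Suc k) \<Longrightarrow> ups Q le C i < ups Q le C j"
  using ups_mono[of i k Q le C] ups_mono[of "Suc k" j Q le C] by (simp add: ups_Suc)

lemma ups_cong: "(\<And>i. i \<le> k \<Longrightarrow> C ! i = C' ! i) \<Longrightarrow> ups Q le C k = ups Q le C' k"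
  unfolding ups_def by (rule arg_cong[where f = card]) auto

lemma len_up_eq_ups: "len_up Q le C = ups Q le C (length C - 1)"
  unfolding len_up_def ups_def by (rule arg_cong[where f = card]) auto

locale finite_poset =
  fixes Q :: "'b set" and le :: "'b \<Rightarrow> 'b \<Rightarrow> bool"
  assumes finite_Q: "finite Q" and partial_order: "partial_order_on_set Q le"
begin

lemma le_refl: "x \<in> Q \<Longrightarrow> le x x"
  and le_antisym: "x \<in> Q \<Longrightarrow> y \<in> Q \<Longrightarrow> le x y \<Longrightarrow> le y x \<Longrightarrow> x = y"
  and le_trans: "x \<in> Q \<Longrightarrow> y \<in> Q \<Longrightarrow> z \<in> Q \<Longrightarrow> le x y \<Longrightarrow> le y z \<Longrightarrow> le x z"
  using partial_order unfolding partial_order_on_set_def by blast+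

lemma covers_asym: "covers Q le x y \<Longrightarrow> \<not> covers Q le y x"
  using le_antisym by (auto simp: covers_def lt_in_def)

lemma reach_imp_walk:
  "reach Q le n x \<Longrightarrow> \<exists>C. is_walk Q le C \<and> last C = x \<and> len_up Q le C \<le> n"
proof (induction rule: reach.induct)
  case (reach_minimal x)
  then show ?case
    by (intro exI[of _ "[x]"]) (auto simp: is_walk_def is_minimal_def len_up_def)
next
  have step: "\<exists>C'. is_walk Q le C' \<and> last C' = y \<and> len_up Q le C' \<le> n + (if covers Q le x y then 1 else 0)"
    if C: "is_walk Q le C" "last C = x" "len_up Q le C \<le> n"
      and xy: "covers Q le x y \<or> covers Q le y x" for C n x y
  \<comment> \<open>Loop erasure: if \<open>y\<close> was visited before, the walk is cut back to
    it, and a prefix costs no more. Hence only \<open>\<le> n\<close> in the conclusion.\<close>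
  proof (cases "y \<in> set C")
    case True
    then obtain k where k: "k < length C" "C ! k = y" by (auto simp: in_set_conv_nth)
    let ?C = "take (Suc k) C"
    have "length ?C - 1 = k" using k by simp
    then have "len_up Q le ?C = ups Q le ?C k" unfolding len_up_eq_ups by simp
    also have "\<dots> = ups Q le C k" by (rule ups_cong) auto
    also have "\<dots> \<le> len_up Q le C" unfolding len_up_eq_ups using k by (intro ups_mono) auto
    finally have 1: "len_up Q le ?C \<le> n" using C by simp
    have 2: "is_walk Q le ?C"
      using C(1) k set_take_subset[of "Suc k" C] by (auto simp: is_walk_def)
    have 3: "last ?C = y" using k by (simp add: take_Suc_conv_app_nth)
    show ?thesis using 1 2 3 by (intro exI[of _ ?C]) auto
  next
    case False
    let ?C = "C @ [y]"
    have ne: "C \<noteq> []" using C by (simp add: is_walk_def)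
    have lst: "C ! (length C - 1) = x" using ne C(2) by (simp add: last_conv_nth)
    have "len_up Q le ?C = ups Q le ?C (Suc (length C - 1))" using ne by (simp add: len_up_eq_ups)
    also have "\<dots> = ups Q le ?C (length C - 1) + (if covers Q le x y then 1 else 0)"
    proof -
      have "?C ! (length C - 1) = x" "?C ! Suc (length C - 1) = y"
        using ne lst by (simp_all add: nth_append)
      then show ?thesis by (simp only: ups_Suc)
    qed
    also have "ups Q le ?C (length C - 1) = len_up Q le C"
      unfolding len_up_eq_ups using ne by (intro ups_cong) (auto simp: nth_append neq_Nil_conv)
    finally have 1: "len_up Q le ?C \<le> n + (if covers Q le x y then 1 else 0)" using C by simp
    have adj: "covers Q le (?C ! i) (?C ! Suc i) \<or> covers Q le (?C ! Suc i) (?C ! i)"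
      if "Suc i < length ?C" for i
    proof (cases "Suc i < length C")
      case True
      then show ?thesis using C(1) by (auto simp: is_walk_def nth_append)
    next
      case False
      then have "i = length C - 1" "Suc i = length C" using that ne by auto
      then show ?thesis using lst xy ne by (auto simp: nth_append)
    qed
    have "is_walk Q le ?C"
      unfolding is_walk_def using adj C(1) False xy ne
      by (auto simp: is_walk_def covers_def nth_append)
    then show ?thesis using 1 by (intro exI[of _ ?C]) auto
  qed
  {
    case (reach_up n x y)
    then show ?case using step[of _ x n y] by (metis Suc_eq_plus1)
  next
    case (reach_down n y x)
    then obtain C where "is_walk Q le C" "last C = y" "len_up Q le C \<le> n" by blast
    then show ?case using step[of C y n x] reach_down(2) covers_asym by (metis add.right_neutral)
  }
qed

end

section \<open>Positions of local extrema and finite induction along covers\<close>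

lemma nth_sorted_list_of_set_less:
  fixes S :: "nat set"
  assumes "j < k" "k < length (sorted_list_of_set S)"
  shows "sorted_list_of_set S ! j < sorted_list_of_set S ! k"
  by (rule sorted_wrt_nth_less[OF strict_sorted_list_of_set assms])

lemma card_le_nth_sorted_list_of_set:
  fixes S :: "nat set"
  assumes "finite S" "i < length (sorted_list_of_set S)"
  shows "card {s \<in> S. s \<le> sorted_list_of_set S ! i} = Suc i"
proof -
  let ?xs = "sorted_list_of_set S"
  have less: "?xs ! j < ?xs ! k \<longleftrightarrow> j < k" if "j < length ?xs" "k < length ?xs" for j k
    using nth_sorted_list_of_set_less[of j k S] nth_sorted_list_of_set_less[of k j S] that
    by (cases j k rule: linorder_cases) auto
  have "{s \<in> S. s \<le> ?xs ! i} = {s \<in> set ?xs. s \<le> ?xs ! i}" using assms(1) by simp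
  also have "\<dots> = (\<lambda>j. ?xs ! j) ` {..i}"
  proof (intro equalityI subsetI)
    fix s assume "s \<in> {s \<in> set ?xs. s \<le> ?xs ! i}"
    then obtain j where "j < length ?xs" "s = ?xs ! j" "?xs ! j \<le> ?xs ! i"
      by (auto simp: in_set_conv_nth simp del: set_sorted_list_of_set)
    then show "s \<in> (\<lambda>j. ?xs ! j) ` {..i}" using less[of i j] assms(2) by auto
  next
    fix s assume "s \<in> (\<lambda>j. ?xs ! j) ` {..i}"
    then obtain j where "j \<le> i" "s = ?xs ! j" by auto
    then show "s \<in> {s \<in> set ?xs. s \<le> ?xs ! i}"
      using less[of i j] assms(2) by (auto simp del: set_sorted_list_of_set)
  qed
  also have "card \<dots> = card {..i}"
    using distinct_sorted_list_of_set[of S] assms(2)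
    by (intro card_image) (auto simp: inj_on_def nth_eq_iff_index_eq)
  finally show ?thesis by simp
qed

context finite_poset
begin

lemma lt_in_trans: "x \<in> Q \<Longrightarrow> y \<in> Q \<Longrightarrow> z \<in> Q \<Longrightarrow> lt_in le x y \<Longrightarrow> lt_in le y z \<Longrightarrow> lt_in le x z"
  unfolding lt_in_def using le_trans[of x y z] le_antisym by metis

lemma ex_max_element:
  assumes "S \<subseteq> Q" "S \<noteq> {}"
  shows "\<exists>m\<in>S. \<forall>z\<in>S. \<not> lt_in le m z"
proof -
  have "asymp_on S (lt_in le)"
    using assms le_antisym by (intro asymp_onI) (auto simp: lt_in_def)
  moreover have "transp_on S (lt_in le)"
    using assms lt_in_trans by (intro transp_onI) blast
  ultimately show ?thesis
    using Finite_Set.bex_max_element[of S "lt_in le"] assms finite_subset[OF _ finite_Q]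
    by (metis lt_in_def)
qed

lemma ex_maximal: "Q \<noteq> {} \<Longrightarrow> \<exists>x. is_maximal Q le x"
  using ex_max_element[of Q] by (auto simp: is_maximal_def)

lemma ex_cover_below:
  assumes "x \<in> Q" "y \<in> Q" "lt_in le x y"
  shows "\<exists>z. covers Q le z y \<and> le x z"
proof -
  let ?S = "{z \<in> Q. le x z \<and> lt_in le z y}"
  have "x \<in> ?S" using assms le_refl by auto
  then obtain m where m: "m \<in> ?S" "\<forall>z\<in>?S. \<not> lt_in le m z"
    using ex_max_element[of ?S] by blast
  have "\<not> lt_in le m z" if "z \<in> Q" "lt_in le z y" for z
    using m le_trans[of x m z] that assms by (auto simp: lt_in_def)
  then have "covers Q le m y" using m(1) assms by (auto simp: covers_def)
  then show ?thesis using m(1) by auto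
qed

text \<open>The size of the principal ideal is the measure for induction up the poset.\<close>

lemma card_down_less:
  assumes "x \<in> Q" "y \<in> Q" "lt_in le x y"
  shows "card {w \<in> Q. le w x} < card {w \<in> Q. le w y}"
proof (rule psubset_card_mono)
  show "{w \<in> Q. le w x} \<subset> {w \<in> Q. le w y}"
    using assms le_refl[of y] le_antisym[of x y] le_trans[of _ x y] by (auto simp: lt_in_def)
qed (simp add: finite_Q)

lemma reach_mem: "reach Q le n x \<Longrightarrow> x \<in> Q"
  by (induction rule: reach.induct) (auto simp: is_minimal_def covers_def)

text \<open>Descend along a saturated chain; each downward step is free. So the elements reachable
  at a given cost form an ideal.\<close>

lemma reach_le:
  assumes "reach Q le n y" "x \<in> Q" "le x y"
  shows "reach Q le n x"
  using assms
proof (induction "card {w \<in> Q. le w y}" arbitrary: y rule: less_induct)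
  case less
  note y = reach_mem[OF less.prems(1)]
  show ?case
  proof (cases "x = y")
    case False
    then obtain z where z: "covers Q le z y" "le x z"
      using ex_cover_below[of x y] less.prems y by (auto simp: lt_in_def)
    then have "card {w \<in> Q. le w z} < card {w \<in> Q. le w y}"
      using y by (intro card_down_less) (auto simp: covers_def)
    then show ?thesis using less.hyps z less.prems reach_down by metis
  qed (use less in simp)
qed

text \<open>A finite order is generated by its covers. This reduces membership in the cone of
  exponents to its facets.\<close>

lemma antitone_if_covers:
  fixes f :: "'b \<Rightarrow> 'c::preorder"
  assumes f: "\<And>x y. covers Q le x y \<Longrightarrow> f y \<le> f x" and "x \<in> Q" "y \<in> Q" "le x y"
  shows "f y \<le> f x"
  using assms(3,4)
proof (induction "card {w \<in> Q. le w y}" arbitrary: y rule: less_induct)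
  case less
  show ?case
  proof (cases "x = y")
    case False
    then obtain z where z: "covers Q le z y" "le x z"
      using ex_cover_below[of x y] less.prems assms(2) by (auto simp: lt_in_def)
    then have "card {w \<in> Q. le w z} < card {w \<in> Q. le w y}" "z \<in> Q"
      by (auto intro!: card_down_less simp: covers_def)
    then have "f z \<le> f x" using less.hyps z by blast
    then show ?thesis using f[OF z(1)] order_trans by blast
  qed simp
qed

lemma ex_reach: "x \<in> Q \<Longrightarrow> \<exists>n. reach Q le n x"
proof (induction "card {w \<in> Q. le w x}" arbitrary: x rule: less_induct)
  case less
  show ?case
  proof (cases "is_minimal Q le x")
    case True
    then have "reach Q le 0 x" by (rule reach_minimal)
    then show ?thesis ..
  next
    case False
    then obtain z where z: "covers Q le z x"
      using less.prems ex_cover_below[of _ x] by (auto simp: is_minimal_def)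
    then have "card {w \<in> Q. le w z} < card {w \<in> Q. le w x}" "z \<in> Q"
      by (auto intro!: card_down_less simp: covers_def)
    then obtain n where "reach Q le n z" using less.hyps by blast
    then show ?thesis using reach_up z by metis
  qed
qed

text \<open>The tail of a walk can be grafted onto any other way of reaching one of its vertices, at
  the cost of the tail alone.\<close>

lemma reach_along_walk:
  assumes C: "is_walk Q le C" and "i \<le> j" "j < length C" and i: "reach Q le n (C ! i)"
  shows "reach Q le (n + (ups Q le C j - ups Q le C i)) (C ! j)"
  using assms(2,3)
proof (induction j rule: dec_induct)
  case base
  then show ?case using i by simp
next
  case (step j)
  then have r: "reach Q le (n + (ups Q le C j - ups Q le C i)) (C ! j)" by simp
  have "covers Q le (C ! j) (C ! Suc j) \<or> covers Q le (C ! Suc j) (C ! j)"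
    using C step.prems by (auto simp: is_walk_def)
  then show ?case
  proof
    assume "covers Q le (C ! j) (C ! Suc j)"
    then show ?thesis
      using reach_up[OF r] ups_mono[OF step.hyps(1), of Q le C] by (simp add: ups_Suc Suc_diff_le)
  next
    assume *: "covers Q le (C ! Suc j) (C ! j)"
    then show ?thesis using reach_down[OF r *] covers_asym by (simp add: ups_Suc)
  qed
qed

lemma maximal_path_imp_walk: "is_maximal_path Q le C \<Longrightarrow> is_walk Q le C"
  by (auto simp: is_maximal_path_def is_path_def is_walk_def)

lemma walk_imp_maximal_path:
  assumes "is_walk Q le C" "is_maximal Q le (last C)"
  shows "is_maximal_path Q le C"
proof -
  have "covers Q le (C ! (length C - 2)) (C ! (length C - 1))" if "2 \<le> length C"
  proof -
    have "Suc (length C - 2) = length C - 1" using that by simp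
    then have "covers Q le (C ! (length C - 2)) (C ! (length C - 1)) \<or>
          covers Q le (C ! (length C - 1)) (C ! (length C - 2))"
      using assms(1) that unfolding is_walk_def
      by (metis One_nat_def Suc_1 Suc_le_lessD diff_less less_le_trans zero_less_Suc lessI)
    moreover have "last C = C ! (length C - 1)" using assms by (auto simp: is_walk_def last_conv_nth)
    ultimately show ?thesis using assms(2) by (auto simp: is_maximal_def covers_def)
  qed
  then show ?thesis using assms by (auto simp: is_maximal_path_def is_path_def is_walk_def)
qed

lemma reach_len_up:
  assumes "is_walk Q le C"
  shows "reach Q le (len_up Q le C) (last C)"
proof -
  have "C \<noteq> []" and min: "is_minimal Q le (C ! 0)" using assms by (auto simp: is_walk_def)
  then show ?thesis
    using reach_along_walk[OF assms, of 0 "length C - 1" 0] reach_minimal[OF min]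
    by (simp add: len_up_eq_ups last_conv_nth)
qed

text \<open>The blocks are cut out by two separately sorted lists, so their alternation has to be
  derived. The second claim ensures that the index into \<open>lmin_pos\<close> is in range. Both
  follow by counting extrema up to a position.\<close>

lemma lmin_pos_interlace:
  assumes C: "is_maximal_path Q le C" and i: "Suc i < num_blocks Q le C"
  shows "lmax_pos Q le C ! i < lmin_pos Q le C ! Suc i"
    and "Suc i < length (lmin_pos Q le C)"
proof -
  define N where "N = length C"
  define U where "U k = covers Q le (C ! k) (C ! Suc k)" for k
  define cmax where "cmax k = card {j \<in> {j. loc_max Q le C j}. j \<le> k}" for k
  define cmin where "cmin k = card {j \<in> {j. loc_min Q le C j}. j \<le> k}" for k
  let ?a = "lmax_pos Q le C" and ?b = "lmin_pos Q le C"
  have fin: "finite {j. loc_max Q le C j}" "finite {j. loc_min Q le C j}"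
    by (auto simp: loc_max_def loc_min_def)
  note walk = maximal_path_imp_walk[OF C]
  have adj: "covers Q le (C ! Suc k) (C ! k) \<longleftrightarrow> \<not> U k" if "Suc k < N" for k
    using walk that covers_asym unfolding is_walk_def U_def N_def by blast
  have a_le: "?a ! k \<le> N - 1" "?a ! k \<in> {j. loc_max Q le C j}" if "k < length ?a" for k
  proof -
    show "?a ! k \<in> {j. loc_max Q le C j}"
      using nth_mem[OF that] fin by (simp add: lmax_pos_def)
    then show "?a ! k \<le> N - 1" by (auto simp: loc_max_def N_def)
  qed
  have ai: "?a ! i < ?a ! Suc i"
    unfolding lmax_pos_def
    by (rule nth_sorted_list_of_set_less) (use i in \<open>simp_all add: num_blocks_def lmax_pos_def\<close>)
  then have aiN: "?a ! i < N - 1" using a_le(1)[of "Suc i"] i by (simp add: num_blocks_def)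
  then have N2: "2 \<le> N" by simp
  have card_Suc: "card {j \<in> {j. R j}. j \<le> Suc k} = card {j \<in> {j. R j}. j \<le> k} + (if R (Suc k) then 1 else 0)"
    for R :: "nat \<Rightarrow> bool" and k
  proof -
    have "{j \<in> {j. R j}. j \<le> Suc k} = (if R (Suc k) then insert (Suc k) {j \<in> {j. R j}. j \<le> k} else {j \<in> {j. R j}. j \<le> k})"
      by (auto simp: le_Suc_eq)
    then show ?thesis by auto
  qed
  \<comment> \<open>Extrema alternate, beginning with the minimum at position 0; the minima lead by
    one exactly when the step out of position k goes up.\<close>
  have inv: "Suc k < N \<Longrightarrow> cmin k = cmax k + (if U k then 1 else 0)" for k
  proof (induction k)
    case 0
    have "U 0" using adj[of 0] 0 walk by (auto simp: is_walk_def is_minimal_def covers_def)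
    moreover have "{j \<in> {j. loc_min Q le C j}. j \<le> 0} = {0}" using 0 by (auto simp: loc_min_def N_def)
    moreover have "{j \<in> {j. loc_max Q le C j}. j \<le> 0} = {}" using 0 by (auto simp: loc_max_def N_def)
    ultimately show ?case by (simp add: cmin_def cmax_def)
  next
    case (Suc k)
    have 1: "loc_max Q le C (Suc k) \<longleftrightarrow> U k \<and> \<not> U (Suc k)"
      using Suc.prems adj[of "Suc k"] by (auto simp: loc_max_def N_def U_def)
    have 2: "loc_min Q le C (Suc k) \<longleftrightarrow> \<not> U k \<and> U (Suc k)"
      using Suc.prems adj[of "k"] by (auto simp: loc_min_def N_def U_def)
    show ?case using Suc 1 2 unfolding cmin_def cmax_def card_Suc by auto
  qed
  have "U (N - 2)"
  proof -
    have "Suc (N - 2) = N - 1" using N2 by simp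
    then show ?thesis using C N2 by (simp add: is_maximal_path_def is_path_def U_def N_def)
  qed
  then have "cmin (N - 2) = cmax (N - 2) + 1" using inv[of "N - 2"] N2 by simp
  \<comment> \<open>The end point is a maximum by convention and the only one beyond position N -
    2.\<close>
  moreover have "length ?a = cmax (N - 2) + 1"
  proof -
    have "Suc (N - 2) = N - 1" using N2 by simp
    moreover have "loc_max Q le C (N - 1)" using N2 by (simp add: loc_max_def N_def)
    moreover have "{j \<in> {j. loc_max Q le C j}. j \<le> N - 1} = {j. loc_max Q le C j}"
      by (auto simp: loc_max_def N_def)
    ultimately show ?thesis
      using card_Suc[of "loc_max Q le C" "N - 2"] by (simp add: cmax_def lmax_pos_def)
  qed
  moreover have "cmin (N - 2) \<le> length ?b"
    unfolding cmin_def lmin_pos_def using fin by (auto intro: card_mono)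
  ultimately show b: "Suc i < length ?b" using i by (simp add: num_blocks_def)
  show "?a ! i < ?b ! Suc i"
  \<comment> \<open>Otherwise at least i + 2 minima occur up to the maximum of index i, whereas
    \<open>inv\<close> gives i + 1 there, because the path goes down next.\<close>
  proof (rule ccontr)
    assume "\<not> ?a ! i < ?b ! Suc i"
    then have "cmin (?b ! Suc i) \<le> cmin (?a ! i)"
      unfolding cmin_def by (intro card_mono) auto
    moreover have "cmin (?b ! Suc i) = Suc (Suc i)"
      unfolding cmin_def lmin_pos_def
      by (rule card_le_nth_sorted_list_of_set) (use fin b in \<open>auto simp: lmin_pos_def\<close>)
    moreover have "cmax (?a ! i) = Suc i"
      unfolding cmax_def lmax_pos_def
      by (rule card_le_nth_sorted_list_of_set) (use fin i in \<open>auto simp: lmax_pos_def num_blocks_def\<close>)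
    moreover have "\<not> U (?a ! i)"
      using a_le(2)[of i] aiN adj[of "?a ! i"] i by (auto simp: loc_max_def N_def num_blocks_def)
    ultimately show False using inv[of "?a ! i"] aiN by simp
  qed
qed

text \<open>Where \<open>star_cond\<close> fails, the path revisits an ideal it has already
  climbed; descending into that ideal is free and skips at least one upward step.\<close>
lemma star_cond_if_min_len_up:
  assumes C: "is_maximal_path Q le C"
    and min: "\<And>n x. is_maximal Q le x \<Longrightarrow> reach Q le n x \<Longrightarrow> len_up Q le C \<le> n"
  shows "star_cond Q le C"
proof -
  let ?u = "ups Q le C" and ?a = "lmax_pos Q le C" and ?b = "lmin_pos Q le C"
  note walk = maximal_path_imp_walk[OF C]
  have ne: "C \<noteq> []" and C0: "is_minimal Q le (C ! 0)" and dist: "distinct C" and sub: "set C \<subseteq> Q"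
    using walk by (auto simp: is_walk_def)
  \<comment> \<open>Descend from \<open>C ! i\<close> to \<open>C ! j\<close> for free and then
    follow \<open>C\<close> to its end; by minimality this saves nothing.\<close>
  have shortcut: "?u j \<le> ?u i" if "i < length C" "j < length C" "le (C ! j) (C ! i)" for i j
  proof -
    have "reach Q le (?u i) (C ! i)"
      using reach_along_walk[OF walk, of 0 i 0] that reach_minimal[OF C0] by simp
    then have "reach Q le (?u i) (C ! j)" using reach_le that sub by (meson nth_mem subsetD)
    then have "reach Q le (?u i + (?u (length C - 1) - ?u j)) (last C)"
      using reach_along_walk[OF walk, of j "length C - 1" "?u i"] that ne by (simp add: last_conv_nth)
    then have "?u (length C - 1) \<le> ?u i + (?u (length C - 1) - ?u j)"
      using min C by (auto simp: is_maximal_path_def len_up_eq_ups)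
    moreover have "?u j \<le> ?u (length C - 1)" using that by (intro ups_mono) auto
    ultimately show ?thesis by linarith
  qed
  have fin: "finite {j. loc_max Q le C j}" "finite {j. loc_min Q le C j}"
    by (auto simp: loc_max_def loc_min_def)
  have a_less: "?a ! m < ?a ! i" if "m < i" "i < num_blocks Q le C" for m i
    unfolding lmax_pos_def
    by (rule nth_sorted_list_of_set_less) (use that in \<open>simp_all add: num_blocks_def lmax_pos_def\<close>)
  have a_max: "loc_max Q le C (?a ! i)" if "i < num_blocks Q le C" for i
    using nth_mem[of i ?a] that fin by (simp add: lmax_pos_def num_blocks_def)
  show ?thesis
    unfolding star_cond_def
  proof (intro allI impI)
    fix i assume i: "Suc i < num_blocks Q le C"
    note il = lmin_pos_interlace[OF C i]
    have bmin: "loc_min Q le C (?b ! Suc i)"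
      using nth_mem[OF il(2)] fin by (simp add: lmin_pos_def)
    then have bN: "?b ! Suc i < length C" by (simp add: loc_min_def)
    have aN: "?a ! m < length C" if "m < num_blocks Q le C" for m
      using a_max[OF that] by (simp add: loc_max_def)
    have ai: "0 < ?a ! i" "covers Q le (C ! (?a ! i - 1)) (C ! (?a ! i))"
      using a_max[of i] i a_less[of i "Suc i"] aN[of "Suc i"] by (auto simp: loc_max_def)
    \<comment> \<open>The step entering a local maximum goes up, so the cost rises strictly there.
      Any later descent below an earlier position would contradict \<open>shortcut\<close>.\<close>
    have up_a: "?u k < ?u j" if "k < ?a ! i" "?a ! i \<le> j" for k j
      using ups_less[of k "?a ! i - 1" j Q le C] ai that by simp
    have D: "C ! j \<notin> (\<Union>m<i. gen_A Q le C m) \<union> gen_A_minus Q le C i \<union> {tA Q le C i}"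
      if "j \<in> D_pos Q le C i" for j
    proof -
      have j: "?a ! i < j" "j < length C" using that bN by (auto simp: D_pos_def)
      have "C ! j \<notin> gen_A Q le C m" if "m < i" for m
        using up_a[of "?a ! m" j] shortcut[of "?a ! m" j] j a_less[of m i] aN[of m] i that
        by (auto simp: gen_A_def tA_def)
      moreover have "C ! j \<notin> gen_A_minus Q le C i"
      proof
        assume "C ! j \<in> gen_A_minus Q le C i"
        then obtain k where "k \<le> ?a ! i" "k \<noteq> ?a ! i" "le (C ! j) (C ! k)"
          by (auto simp: gen_A_minus_def A_pos_def)
        then show False using up_a[of k j] shortcut[of k j] j by simp
      qed
      moreover have "C ! j \<noteq> tA Q le C i"
        using dist j by (simp add: tA_def nth_eq_iff_index_eq)
      ultimately show ?thesis by auto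
    qed
    \<comment> \<open>The upward step leaving the local minimum before this block lies between all
      earlier tops and position j.\<close>
    have A: "C ! j \<notin> gen_A Q le C m" if "j \<in> A_pos Q le C (Suc i)" "m \<le> i" for j m
    proof -
      have j: "?b ! Suc i < j" "j < length C" using that aN[OF i] by (auto simp: A_pos_def)
      have am: "?a ! m < ?b ! Suc i"
        using il(1) a_less[of m i] i that by (cases "m = i") auto
      then have "covers Q le (C ! (?b ! Suc i)) (C ! Suc (?b ! Suc i))"
        using bmin by (auto simp: loc_min_def)
      then have "?u (?a ! m) < ?u j" using ups_less am j by (metis less_imp_le)
      then show ?thesis using shortcut[of "?a ! m" j] j am bN by (auto simp: gen_A_def tA_def)
    qed
    show "(!) C ` D_pos Q le C i \<inter>
          (\<Union> (gen_A Q le C ` {..<i}) \<union> gen_A_minus Q le C i \<union> {tA Q le C i}) = {} \<and>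
         (!) C ` A_pos Q le C (Suc i) \<inter> \<Union> (gen_A Q le C ` {..i}) = {}"
      using D A by blast
  qed
qed

section \<open>The lower rank as a least cost\<close>

lemma ex_reach_maximal:
  assumes "Q \<noteq> {}"
  shows "\<exists>n x. is_maximal Q le x \<and> reach Q le n x"
proof -
  obtain x where x: "is_maximal Q le x" using ex_maximal[OF assms] by blast
  then obtain n where "reach Q le n x" using ex_reach by (auto simp: is_maximal_def)
  with x show ?thesis by blast
qed

lemma lower_rank_eq_Least:
  assumes "Q \<noteq> {}"
  shows "lower_rank Q le = (LEAST n. \<exists>x. is_maximal Q le x \<and> reach Q le n x)"
proof -
  let ?R = "\<lambda>n. \<exists>x. is_maximal Q le x \<and> reach Q le n x"
  let ?L = "LEAST n. ?R n"
  let ?S = "{C. is_maximal_path Q le C \<and> star_cond Q le C}"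
  have RL: "?R ?L" by (rule LeastI_ex[of ?R, OF ex_reach_maximal[OF assms]])
  have le_L: "?L \<le> n" if "is_maximal Q le x" "reach Q le n x" for n x
    using that by (intro Least_le[of ?R]) auto
  obtain x C where x: "is_maximal Q le x" and C: "is_walk Q le C" "last C = x" "len_up Q le C \<le> ?L"
    using RL reach_imp_walk by blast
  have path: "is_maximal_path Q le C" using walk_imp_maximal_path C x by simp
  have "len_up Q le C = ?L" using C(2,3) le_L[OF x] reach_len_up[OF C(1)] by (intro order_antisym) auto
  moreover from this have "star_cond Q le C" using star_cond_if_min_len_up[OF path] le_L by auto
  ultimately have mem: "?L \<in> len_up Q le ` ?S" using path by (intro image_eqI[of _ _ C]) auto
  \<comment> \<open>\<open>Min\<close> needs a finite set; distinct entries bound the length of a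
    path by \<open>card Q\<close>.\<close>
  have "?S \<subseteq> {C. set C \<subseteq> Q \<and> length C \<le> card Q}"
  proof
    fix C assume "C \<in> ?S"
    then have "set C \<subseteq> Q" "distinct C" by (auto simp: is_maximal_path_def is_path_def)
    then show "C \<in> {C. set C \<subseteq> Q \<and> length C \<le> card Q}"
      using card_mono[OF finite_Q, of "set C"] distinct_card[of C] by simp
  qed
  then have fin: "finite (len_up Q le ` ?S)"
    using finite_lists_length_le[OF finite_Q] finite_subset by blast
  have "?L \<le> y" if "y \<in> len_up Q le ` ?S" for y
    using that reach_len_up maximal_path_imp_walk le_L by (auto simp: is_maximal_path_def)
  then have "Min (len_up Q le ` ?S) = ?L" using fin mem by (intro Min_eqI) auto
  moreover have "{len_up Q le C |C. is_maximal_path Q le C \<and> star_cond Q le C} = len_up Q le ` ?S"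
    by blast
  ultimately show ?thesis by (simp add: lower_rank_def)
qed

lemma reach_lower_rank:
  assumes "Q \<noteq> {}"
  shows "\<exists>x. is_maximal Q le x \<and> reach Q le (lower_rank Q le) x"
  unfolding lower_rank_eq_Least[OF assms]
  by (rule LeastI_ex[of "\<lambda>n. \<exists>x. is_maximal Q le x \<and> reach Q le n x", OF ex_reach_maximal[OF assms]])

lemma lower_rank_le:
  assumes "is_maximal Q le x" "reach Q le n x"
  shows "lower_rank Q le \<le> n"
proof -
  have "Q \<noteq> {}" using assms by (auto simp: is_maximal_def)
  then show ?thesis
    unfolding lower_rank_eq_Least[OF \<open>Q \<noteq> {}\<close>]
    using assms by (intro Least_le[of "\<lambda>n. \<exists>x. is_maximal Q le x \<and> reach Q le n x"]) auto
qed

text \<open>The distance from the minimal elements. It rises by 0 or 1 along each cover, so it is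
  the potential that is optimal in the duality.\<close>

definition cost :: "'b \<Rightarrow> nat" where
  "cost x = (LEAST n. reach Q le n x)"

lemma cost_le: "reach Q le n x \<Longrightarrow> cost x \<le> n"
  unfolding cost_def by (rule Least_le)

lemma reach_cost: "x \<in> Q \<Longrightarrow> reach Q le (cost x) x"
  unfolding cost_def by (rule LeastI_ex[OF ex_reach])

lemma cost_mono: "x \<in> Q \<Longrightarrow> y \<in> Q \<Longrightarrow> le x y \<Longrightarrow> cost x \<le> cost y"
  using cost_le reach_le reach_cost by blast

lemma cost_covers: "covers Q le x y \<Longrightarrow> cost y \<le> Suc (cost x)"
  using cost_le[OF reach_up[OF reach_cost]] by (auto simp: covers_def)

end

section \<open>The poset extended by a bottom and a top\<close>

lemma finite_poset_ext:
  assumes "finite_poset P le"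
  shows "finite_poset (ext_carrier P) (ext_le le)"
proof
  interpret finite_poset P le by fact
  show "finite (ext_carrier P)" by (simp add: ext_carrier_def finite_Q)
  show "partial_order_on_set (ext_carrier P) (ext_le le)"
    unfolding partial_order_on_set_def
  proof (intro conjI ballI impI; (elim conjE)?)
    fix X assume "X \<in> ext_carrier P"
    then show "ext_le le X X"
      using le_refl by (cases X) (auto simp: ext_carrier_def)
  next
    fix X Y assume "X \<in> ext_carrier P" "Y \<in> ext_carrier P" "ext_le le X Y" "ext_le le Y X"
    then show "X = Y"
      by (cases X; cases Y) (auto simp: ext_carrier_def intro: le_antisym)
  next
    fix X Y Z assume "X \<in> ext_carrier P" "Y \<in> ext_carrier P" "Z \<in> ext_carrier P"
      "ext_le le X Y" "ext_le le Y Z"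
    then show "ext_le le X Z"
      by (cases X; cases Y; cases Z) (auto simp: ext_carrier_def intro: le_trans)
  qed
qed

lemma lt_in_ext [simp]:
  "lt_in (ext_le le) (Fin x) (Fin y) \<longleftrightarrow> lt_in le x y"
  "lt_in (ext_le le) NegInf Y \<longleftrightarrow> Y \<noteq> NegInf"
  "lt_in (ext_le le) X PosInf \<longleftrightarrow> X \<noteq> PosInf"
  "\<not> lt_in (ext_le le) X NegInf"
  "\<not> lt_in (ext_le le) PosInf Y"
  by (cases X; auto simp: lt_in_def)+

lemma covers_ext [simp]:
  "covers (ext_carrier P) (ext_le le) (Fin x) (Fin y) \<longleftrightarrow> covers P le x y"
  "covers (ext_carrier P) (ext_le le) NegInf (Fin x) \<longleftrightarrow> is_minimal P le x"
  "covers (ext_carrier P) (ext_le le) (Fin x) PosInf \<longleftrightarrow> is_maximal P le x"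
  "\<not> covers (ext_carrier P) (ext_le le) X NegInf"
  "\<not> covers (ext_carrier P) (ext_le le) PosInf Y"
  by (auto simp: covers_def ext_carrier_def is_minimal_def is_maximal_def)

text \<open>For empty P the extension is a single cover, of rank 1; excluding this is what allows
  the summand 2 below.\<close>

lemma not_covers_ext_NegInf_PosInf:
  "P \<noteq> {} \<Longrightarrow> \<not> covers (ext_carrier P) (ext_le le) NegInf PosInf"
  by (auto simp: covers_def ext_carrier_def)

lemma is_minimal_ext [simp]: "is_minimal (ext_carrier P) (ext_le le) X \<longleftrightarrow> X = NegInf"
  by (cases X) (auto simp: is_minimal_def ext_carrier_def)

lemma is_maximal_ext [simp]: "is_maximal (ext_carrier P) (ext_le le) X \<longleftrightarrow> X = PosInf"
  by (cases X) (auto simp: is_maximal_def ext_carrier_def)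

lemma reach_imp_reach_ext:
  "reach P le n x \<Longrightarrow> reach (ext_carrier P) (ext_le le) (Suc n) (Fin x)"
proof (induction rule: reach.induct)
  case (reach_minimal x)
  then show ?case by (auto intro: reach_up[OF reach.reach_minimal[of _ _ NegInf]])
next
  case (reach_up n x y)
  then show ?case by (auto intro: reach.reach_up[OF reach_up.IH])
next
  case (reach_down n y x)
  then show ?case by (auto intro: reach.reach_down[OF reach_down.IH])
qed

text \<open>A walk in the extended poset may also touch the two new elements in its interior; the first
  disjunct covers the walks that have already been at the top.\<close>
lemma reach_ext_imp_reach:
  assumes "P \<noteq> {}" "reach (ext_carrier P) (ext_le le) n X"
  shows "(\<exists>m x. m + 2 \<le> n \<and> is_maximal P le x \<and> reach P le m x) \<or> X = NegInf \<or>
    (\<exists>x m. X = Fin x \<and> m < n \<and> reach P le m x)"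
  using assms(2)
proof (induction rule: reach.induct)
  case (reach_minimal X)
  then show ?case by simp
next
  case (reach_up n X Y)
  show ?case
  proof (cases "\<exists>m x. m + 2 \<le> n \<and> is_maximal P le x \<and> reach P le m x")
    case True
    then show ?thesis by (meson le_Suc_eq)
  next
    case False
    then consider "X = NegInf" | x m where "X = Fin x" "m < n" "reach P le m x"
      using reach_up.IH by blast
    then show ?thesis
    proof cases
      case 1
      then show ?thesis
        using reach_up.hyps(2) not_covers_ext_NegInf_PosInf[OF assms(1), of le] reach.reach_minimal[of P le]
        by (cases Y) auto
    next
      case 2
      show ?thesis
      proof (cases Y)
        case PosInf
        then have "m + 2 \<le> Suc n \<and> is_maximal P le x \<and> reach P le m x" using 2 reach_up.hyps(2) by auto
        then show ?thesis by blast
      next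
        case (Fin y)
        then have "Suc m < Suc n \<and> reach P le (Suc m) y" using 2 reach_up.hyps(2) reach.reach_up by auto
        then show ?thesis using Fin by blast
      qed simp
    qed
  qed
next
  case (reach_down n Y X)
  then consider "\<exists>m x. m + 2 \<le> n \<and> is_maximal P le x \<and> reach P le m x"
    | "Y = NegInf" | y m where "Y = Fin y" "m < n" "reach P le m y" by blast
  then show ?case
  proof cases
    case 3
    then show ?thesis using reach_down.hyps(2) reach.reach_down[of P le m y] by (cases X) auto
  qed (use reach_down.hyps(2) in auto)
qed

text \<open>The two extra units are the upward steps out of \<open>NegInf\<close> and into
  \<open>PosInf\<close>.\<close>

lemma lower_rank_ext:
  assumes "finite_poset P le" "P \<noteq> {}"
  shows "lower_rank (ext_carrier P) (ext_le le) = lower_rank P le + 2"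
proof (rule antisym)
  interpret P: finite_poset P le by fact
  interpret E: finite_poset "ext_carrier P" "ext_le le" by (rule finite_poset_ext) fact
  obtain x where x: "is_maximal P le x" "reach P le (lower_rank P le) x"
    using P.reach_lower_rank assms by blast
  have "reach (ext_carrier P) (ext_le le) (Suc (Suc (lower_rank P le))) PosInf"
    by (rule reach_up[OF reach_imp_reach_ext[OF x(2)]]) (use x in simp)
  then show "lower_rank (ext_carrier P) (ext_le le) \<le> lower_rank P le + 2"
    using E.lower_rank_le by fastforce
  have "ext_carrier P \<noteq> {}" by (auto simp: ext_carrier_def)
  then have "reach (ext_carrier P) (ext_le le) (lower_rank (ext_carrier P) (ext_le le)) PosInf"
    using E.reach_lower_rank by fastforce
  from reach_ext_imp_reach[OF assms(2) this] obtain m x where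
    m: "m + 2 \<le> lower_rank (ext_carrier P) (ext_le le)" "is_maximal P le x" "reach P le m x" by auto
  then show "lower_rank P le + 2 \<le> lower_rank (ext_carrier P) (ext_le le)"
    using P.lower_rank_le[OF m(2,3)] by linarith
qed

section \<open>Monomials of the Hibi ring\<close>

abbreviation "lookup \<equiv> Poly_Mapping.lookup"
abbreviation "keys \<equiv> Poly_Mapping.keys"

fun ev :: "('a option \<Rightarrow>\<^sub>0 nat) \<Rightarrow> 'a ext \<Rightarrow> nat" where
  "ev z NegInf = lookup z None"
| "ev z (Fin p) = lookup z (Some p)"
| "ev z PosInf = 0"

text \<open>With \<open>NegInf\<close> and \<open>PosInf\<close> included, monotonicity also encodes
  that each exponent is nonnegative and at most the degree. The support condition excludes variables
  from outside P.\<close>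

definition cone :: "'a set \<Rightarrow> ('a \<Rightarrow> 'a \<Rightarrow> bool) \<Rightarrow> ('a option \<Rightarrow>\<^sub>0 nat) set" where
  "cone P le = {z. keys z \<subseteq> insert None (Some ` P) \<and>
     (\<forall>X\<in>ext_carrier P. \<forall>Y\<in>ext_carrier P. ext_le le X Y \<longrightarrow> ev z Y \<le> ev z X)}"

definition ideal_exponent :: "'a set \<Rightarrow> 'a option \<Rightarrow>\<^sub>0 nat" where
  "ideal_exponent I = Poly_Mapping.single None 1 + (\<Sum>p\<in>I. Poly_Mapping.single (Some p) 1)"

definition scale_exponent :: "nat \<Rightarrow> ('b \<Rightarrow>\<^sub>0 nat) \<Rightarrow> 'b \<Rightarrow>\<^sub>0 nat" where
  "scale_exponent q z = Poly_Mapping.map ((*) q) z"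

lemma lookup_scale_exponent [simp]: "lookup (scale_exponent q z) i = q * lookup z i"
  by (simp add: scale_exponent_def Poly_Mapping.map.rep_eq when_def)

lemma ev_scale_exponent [simp]: "ev (scale_exponent q z) X = q * ev z X"
  by (cases X) simp_all

lemma ev_add [simp]: "ev (z + w) X = ev z X + ev w X"
  by (cases X) (simp_all add: lookup_add)

lemma ev_zero [simp]: "ev 0 X = 0"
  by (cases X) simp_all

lemma ext_carrier_simps [simp]:
  "NegInf \<in> ext_carrier P" "PosInf \<in> ext_carrier P" "Fin p \<in> ext_carrier P \<longleftrightarrow> p \<in> P"
  by (auto simp: ext_carrier_def)

lemma ext_le_PosInf [simp]: "ext_le le X PosInf"
  by (cases X) auto

lemma cone_antitone:
  "z \<in> cone P le \<Longrightarrow> X \<in> ext_carrier P \<Longrightarrow> Y \<in> ext_carrier P \<Longrightarrow> ext_le le X Y \<Longrightarrow> ev z Y \<le> ev z X"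
  by (simp add: cone_def)

lemma cone_covers:
  "z \<in> cone P le \<Longrightarrow> covers (ext_carrier P) (ext_le le) X Y \<Longrightarrow> ev z Y \<le> ev z X"
  by (simp add: cone_def covers_def lt_in_def)

lemma lookup_cone_eq_0: "z \<in> cone P le \<Longrightarrow> i \<notin> insert None (Some ` P) \<Longrightarrow> lookup z i = 0"
  by (auto simp: cone_def in_keys_iff)

lemma cone_zero [simp]: "0 \<in> cone P le"
  by (simp add: cone_def)

lemma cone_add: "z \<in> cone P le \<Longrightarrow> w \<in> cone P le \<Longrightarrow> z + w \<in> cone P le"
  using keys_add[of z w] by (auto simp: cone_def intro!: add_mono)

lemma cone_scale_exponent: "z \<in> cone P le \<Longrightarrow> scale_exponent q z \<in> cone P le"
  by (auto simp: cone_def in_keys_iff subset_iff intro!: mult_le_mono)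

lemma cone_eqI:
  assumes "z \<in> cone P le" "w \<in> cone P le" "\<And>X. X \<in> ext_carrier P \<Longrightarrow> ev z X = ev w X"
  shows "z = w"
proof (rule poly_mapping_eqI)
  fix i
  show "lookup z i = lookup w i"
    using assms(3)[of NegInf] assms(3)[of "Fin (the i)"]
      lookup_cone_eq_0[OF assms(1), of i] lookup_cone_eq_0[OF assms(2), of i]
    by (cases i; cases "the i \<in> P") (auto simp: image_iff)
qed

lemma lookup_sum_single_Some:
  "finite I \<Longrightarrow> lookup (\<Sum>p\<in>I. Poly_Mapping.single (Some p) (f p)) (Some x) = (if x \<in> I then f x else (0::nat))"
  "lookup (\<Sum>p\<in>I. Poly_Mapping.single (Some p) (f p)) None = (0::nat)"
  by (simp_all add: lookup_sum lookup_single when_def)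

lemma cone_of_fun:
  assumes "finite P" "h PosInf = 0"
    and anti: "\<And>X Y. X \<in> ext_carrier P \<Longrightarrow> Y \<in> ext_carrier P \<Longrightarrow> ext_le le X Y \<Longrightarrow> h Y \<le> h X"
  obtains z where "z \<in> cone P le" "\<And>X. X \<in> ext_carrier P \<Longrightarrow> ev z X = h X"
proof -
  define z where "z = Poly_Mapping.single None (h NegInf) + (\<Sum>p\<in>P. Poly_Mapping.single (Some p) (h (Fin p)))"
  have ev: "ev z X = h X" if "X \<in> ext_carrier P" for X
    using that assms(1,2) by (cases X) (auto simp: z_def lookup_add lookup_sum_single_Some lookup_single)
  have "i \<in> insert None (Some ` P)" if "i \<in> keys z" for i
    using that assms(1) by (cases i) (auto simp: z_def in_keys_iff lookup_add lookup_sum_single_Some lookup_single split: if_splits)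
  then have "z \<in> cone P le" using ev anti by (auto simp: cone_def)
  with ev show ?thesis using that by blast
qed

lemma lookup_ideal_exponent [simp]:
  "lookup (ideal_exponent I) None = 1"
  "finite I \<Longrightarrow> lookup (ideal_exponent I) (Some p) = (if p \<in> I then 1 else 0)"
  by (simp_all add: ideal_exponent_def lookup_add lookup_sum_single_Some lookup_single)

lemma ideal_exponent_cone:
  assumes "finite P" "I \<in> poset_ideals P le"
  shows "ideal_exponent I \<in> cone P le"
proof -
  have I: "I \<subseteq> P" "finite I" using assms finite_subset by (auto simp: poset_ideals_def)
  have "ev (ideal_exponent I) Y \<le> ev (ideal_exponent I) X"
    if "X \<in> ext_carrier P" "Y \<in> ext_carrier P" "ext_le le X Y" for X Y
    using that assms(2) I by (cases X; cases Y) (auto simp: poset_ideals_def)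
  moreover have "i \<in> insert None (Some ` P)" if "i \<in> keys (ideal_exponent I)" for i
    using that I by (cases i)
      (auto simp: ideal_exponent_def in_keys_iff lookup_add lookup_sum_single_Some lookup_single split: if_splits)
  ultimately show ?thesis by (auto simp: cone_def)
qed

text \<open>Peel off level sets: the support of an antitone function is an ideal, and lowering all
  positive values by one keeps the function antitone while the degree drops by one.\<close>

lemma cone_decomposition:
  assumes "finite P" "z \<in> cone P le"
  shows "\<exists>Is. set Is \<subseteq> poset_ideals P le \<and> length Is = lookup z None \<and> z = sum_list (map ideal_exponent Is)"
  using assms(2)
proof (induction "lookup z None" arbitrary: z)
  case 0
  have "ev z X = ev 0 X" if "X \<in> ext_carrier P" for X
    using cone_antitone[OF 0(2) _ that, of NegInf] 0(1) by simp
  then have "z = 0" using cone_eqI 0(2) cone_zero by blast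
  then show ?case by (intro exI[of _ "[]"]) auto
next
  case (Suc n)
  define I where "I = {p \<in> P. 0 < ev z (Fin p)}"
  have I: "I \<in> poset_ideals P le"
    using cone_antitone[OF Suc.prems, of "Fin _" "Fin _"]
    by (fastforce simp: I_def poset_ideals_def)
  have fI: "finite I" using assms(1) by (simp add: I_def)
  obtain w where w: "w \<in> cone P le" "\<And>X. X \<in> ext_carrier P \<Longrightarrow> ev w X = ev z X - 1"
    by (rule cone_of_fun[OF assms(1), of "\<lambda>X. ev z X - 1" le])
      (use cone_antitone[OF Suc.prems] in \<open>auto intro: diff_le_mono\<close>)
  have zw: "z = ideal_exponent I + w"
  proof (rule cone_eqI[OF Suc.prems cone_add[OF ideal_exponent_cone[OF assms(1) I] w(1)]])
    fix X assume X: "X \<in> ext_carrier P"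
    then show "ev z X = ev (ideal_exponent I + w) X"
      using w(2)[OF X] Suc.hyps(2) fI
      by (cases X) (auto simp: I_def lookup_add)
  qed
  have "n = lookup w None" using w(2)[of NegInf] Suc.hyps(2) by simp
  from Suc.hyps(1)[OF this w(1)] obtain Is where "set Is \<subseteq> poset_ideals P le"
    "length Is = lookup w None" "w = sum_list (map ideal_exponent Is)" by blast
  then show ?case using zw I \<open>n = lookup w None\<close> Suc.hyps(2)
    by (intro exI[of _ "I # Is"]) auto
qed

section \<open>The ring and the powers of its maximal ideal in terms of exponents\<close>

lemma hibi_gen_eq: "hibi_gen I = Poly_Mapping.single (ideal_exponent I) 1"
  by (simp add: hibi_gen_def ideal_exponent_def)

lemma prod_list_hibi_gen:
  "prod_list (map hibi_gen Is) = Poly_Mapping.single (sum_list (map ideal_exponent Is)) 1"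
  by (induction Is) (simp_all add: hibi_gen_eq mult_single)

lemma single_power:
  fixes c :: "'k::comm_ring_1"
  shows "Poly_Mapping.single u c ^ q = Poly_Mapping.single (scale_exponent q u) (c ^ q)"
proof (induction q)
  case 0
  have "scale_exponent 0 u = 0" by (rule poly_mapping_eqI) simp
  then show ?case by simp
next
  case (Suc q)
  have "u + scale_exponent q u = scale_exponent (Suc q) u"
    by (rule poly_mapping_eqI) (simp add: lookup_add)
  then show ?case by (simp add: Suc mult_single)
qed

lemma lookup_single_mult_add:
  fixes f :: "'b::cancel_comm_monoid_add \<Rightarrow>\<^sub>0 'k::comm_ring_1"
  shows "lookup (Poly_Mapping.single u c * f) (u + w) = c * lookup f w"
  by (simp add: lookup_mult lookup_single when_mult)

lemma lookup_const_mult: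
  fixes f :: "'b::cancel_comm_monoid_add \<Rightarrow>\<^sub>0 'k::comm_ring_1"
  shows "lookup (Poly_Mapping.single 0 c * f) w = c * lookup f w"
  using lookup_single_mult_add[of 0 c f w] by simp

lemma keys_single_mult:
  fixes f :: "'b::cancel_comm_monoid_add \<Rightarrow>\<^sub>0 'k::comm_ring_1"
  assumes "w \<in> keys (Poly_Mapping.single u c * f)"
  shows "\<exists>v\<in>keys f. w = u + v"
  using assms keys_mult[of "Poly_Mapping.single u c" f] by (auto split: if_splits)

lemma sum_single_keys:
  fixes f :: "'b \<Rightarrow>\<^sub>0 'k::comm_monoid_add"
  shows "(\<Sum>z\<in>keys f. Poly_Mapping.single z (lookup f z)) = f"
  by (rule poly_mapping_eqI) (simp add: lookup_sum lookup_single when_def in_keys_iff)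

lemma hibi_ring_one: "1 \<in> hibi_ring P le"
  using hibi_ring.const[of 1] by (simp add: const_poly_def)

lemma hibi_ring_zero: "0 \<in> hibi_ring P le"
  using hibi_ring.const[of 0] by (simp add: const_poly_def)

lemma hibi_ring_sum: "(\<And>i. i \<in> A \<Longrightarrow> f i \<in> hibi_ring P le) \<Longrightarrow> sum f A \<in> hibi_ring P le"
  by (induction A rule: infinite_finite_induct) (auto intro: hibi_ring_zero hibi_ring.add)

lemma hibi_ring_power: "x \<in> hibi_ring P le \<Longrightarrow> x ^ n \<in> hibi_ring P le"
  by (induction n) (auto intro: hibi_ring_one hibi_ring.mult)

lemma hibi_ring_prod_list:
  "(\<And>x. x \<in> set xs \<Longrightarrow> x \<in> hibi_ring P le) \<Longrightarrow> prod_list xs \<in> hibi_ring P le"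
  by (induction xs) (auto intro: hibi_ring_one hibi_ring.mult)

lemma single_in_hibi_ring:
  assumes "finite P" "z \<in> cone P le"
  shows "Poly_Mapping.single z c \<in> hibi_ring P le"
proof -
  obtain Is where "set Is \<subseteq> poset_ideals P le" "z = sum_list (map ideal_exponent Is)"
    using cone_decomposition[OF assms] by blast
  then have "const_poly c * prod_list (map hibi_gen Is) \<in> hibi_ring P le"
    by (auto intro!: hibi_ring.mult hibi_ring.const hibi_ring_prod_list hibi_ring.gen)
  then show ?thesis
    using \<open>z = _\<close> by (simp add: prod_list_hibi_gen const_poly_def mult_single)
qed

text \<open>The ring is the semigroup ring of \<open>cone\<close>, so membership is tested on each
  monomial separately.\<close>

lemma hibi_ring_iff_keys:
  assumes "finite P"
  shows "x \<in> hibi_ring P le \<longleftrightarrow> keys x \<subseteq> cone P le"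
proof
  assume "x \<in> hibi_ring P le"
  then show "keys x \<subseteq> cone P le"
  proof induction
    case (mult x y)
    then show ?case using keys_mult[of x y] by (force intro: cone_add)
  next
    case (add x y)
    then show ?case using keys_add[of x y] by blast
  qed (auto simp: const_poly_def hibi_gen_eq ideal_exponent_cone assms)
next
  assume "keys x \<subseteq> cone P le"
  then have "(\<Sum>z\<in>keys x. Poly_Mapping.single z (lookup x z)) \<in> hibi_ring P le"
    by (auto intro!: hibi_ring_sum single_in_hibi_ring assms)
  then show "x \<in> hibi_ring P le" by (simp add: sum_single_keys)
qed

lemma max_ideal_pow_keys:
  assumes "finite P" "d \<in> max_ideal_pow P le n" "z \<in> keys d"
  shows "z \<in> cone P le \<and> n \<le> lookup z None"
proof -
  have len: "lookup (sum_list (map ideal_exponent Is)) None = length Is" for Is :: "'a set list"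
    by (induction Is) (auto simp: lookup_add)
  have "keys (sum_list (map (\<lambda>(r, Is). r * prod_list (map hibi_gen Is)) L)) \<subseteq> {z \<in> cone P le. n \<le> lookup z None}"
    if "\<forall>(r, Is) \<in> set L. r \<in> hibi_ring P le \<and> length Is = n \<and> set Is \<subseteq> poset_ideals P le"
    for L :: "(('a, 'b) hpoly \<times> 'a set list) list"
    using that
  proof (induction L)
    case (Cons a L)
    obtain r Is where a: "a = (r, Is)" by (cases a)
    have r: "r \<in> hibi_ring P le" "length Is = n" "set Is \<subseteq> poset_ideals P le"
      using Cons.prems a by auto
    have "r * prod_list (map hibi_gen Is) \<in> hibi_ring P le"
      using r by (auto intro!: hibi_ring.mult hibi_ring_prod_list hibi_ring.gen)
    then have "keys (r * prod_list (map hibi_gen Is)) \<subseteq> cone P le"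
      using hibi_ring_iff_keys[OF assms(1)] by blast
    moreover have "n \<le> lookup w None" if "w \<in> keys (r * prod_list (map hibi_gen Is))" for w
      using keys_mult[of r "prod_list (map hibi_gen Is)"] that r(2)
      by (auto simp: prod_list_hibi_gen lookup_add len)
    ultimately show ?case
      using Cons a keys_add[of "r * prod_list (map hibi_gen Is)"
          "sum_list (map (\<lambda>(r, Is). r * prod_list (map hibi_gen Is)) L)"] by auto
  qed simp
  then show ?thesis using assms(2,3) unfolding max_ideal_pow_def by blast
qed

lemma single_in_max_ideal_pow:
  assumes "finite P" "z \<in> cone P le"
  shows "Poly_Mapping.single z 1 \<in> max_ideal_pow P le (lookup z None)"
proof -
  obtain Is where Is: "set Is \<subseteq> poset_ideals P le" "length Is = lookup z None"
    "z = sum_list (map ideal_exponent Is)"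
    using cone_decomposition[OF assms] by blast
  show ?thesis
    unfolding max_ideal_pow_def
    by (rule CollectI, rule exI[of _ "[(1, Is)]"])
      (use Is in \<open>simp add: prod_list_hibi_gen hibi_ring_one\<close>)
qed

section \<open>Splittings and slopes\<close>

text \<open>The rounding step: an excess of at most q - 1 disappears on dividing by q.\<close>

lemma nat_le_of_mult_le:
  fixes a b q v :: nat
  assumes "q * a \<le> q * b + (q - 1) * v" "v \<le> 1" "0 < q"
  shows "a \<le> b"
proof (rule ccontr)
  assume "\<not> a \<le> b"
  then have "q * (b + 1) \<le> q * a" by (intro mult_le_mono) auto
  also have "\<dots> \<le> q * b + (q - 1)" using assms(1) mult_le_mono2[OF assms(2), of "q - 1"] by linarith
  finally show False using assms(3) by simp
qed

section \<open>Frobenius in characteristic p\<close>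

lemma CHAR_poly_mapping:
  "CHAR('b::comm_monoid_add \<Rightarrow>\<^sub>0 'k::comm_ring_1) = CHAR('k)"
proof (rule CHAR_eqI)
  have *: "(of_nat n :: 'b \<Rightarrow>\<^sub>0 'k) = Poly_Mapping.single 0 (of_nat n)" for n
    by simp
  show "of_nat CHAR('k) = (0 :: 'b \<Rightarrow>\<^sub>0 'k)" unfolding * by (simp del: single_of_nat)
  show "CHAR('k) dvd n" if "of_nat n = (0 :: 'b \<Rightarrow>\<^sub>0 'k)" for n
  proof -
    have "lookup (Poly_Mapping.single 0 (of_nat n) :: 'b \<Rightarrow>\<^sub>0 'k) 0 = 0" using that by simp
    then show ?thesis by (simp add: of_nat_eq_0_iff_char_dvd del: single_of_nat)
  qed
qed

lemma bij_frobenius_power: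
  assumes "CHAR('k::field) > 0" "perfect_field TYPE('k)"
  shows "bij (\<lambda>x::'k. x ^ (CHAR('k) ^ e))"
proof -
  have prime: "prime CHAR('k)" using assms(1) by (rule prime_CHAR_semidom)
  have "x = y" if "x ^ (CHAR('k) ^ e) = y ^ (CHAR('k) ^ e)" for x y :: 'k
    using freshmans_dream'[OF prime refl, of "x - y" y e] that by simp
  moreover have "\<exists>y::'k. y ^ (CHAR('k) ^ e) = x" for x
  proof (induction e arbitrary: x)
    case (Suc e)
    obtain z :: 'k where "z ^ CHAR('k) = x" using assms(2) by (auto simp: perfect_field_def)
    moreover obtain y :: 'k where "y ^ (CHAR('k) ^ e) = z" using Suc by blast
    ultimately show ?case by (auto simp: power_mult mult.commute[of "CHAR('k)"])
  qed auto
  ultimately show ?thesis by (metis bijI injI surjI)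
qed

text \<open>\<open>rt\<close> is the inverse of the e-fold Frobenius, a bijection on a perfect
  field; it is the part of the splitting that acts on coefficients.\<close>

lemma frobenius_root:
  assumes "CHAR('k::field) > 0" "perfect_field TYPE('k)"
  obtains rt :: "'k::field \<Rightarrow> 'k" where "\<And>a b. rt (a + b) = rt a + rt b"
    "\<And>c a. rt (c ^ (CHAR('k::field) ^ e) * a) = c * rt a" "rt 0 = 0" "rt 1 = 1"
proof
  let ?q = "CHAR('k) ^ e"
  let ?rt = "inv (\<lambda>x::'k. x ^ ?q)"
  note bij = bij_frobenius_power[OF assms, of e]
  have prime: "prime CHAR('k)" using assms(1) by (rule prime_CHAR_semidom)
  have rtI: "?rt a = b" if "b ^ ?q = a" for a b
    using inv_f_f[OF bij_is_inj[OF bij], of b] that by simp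
  have rt: "?rt a ^ ?q = a" for a
    using surj_f_inv_f[OF bij_is_surj[OF bij]] by simp
  show "?rt (a + b) = ?rt a + ?rt b" for a b
    by (rule rtI) (simp add: freshmans_dream'[OF prime refl] rt)
  show "?rt (c ^ ?q * a) = c * ?rt a" for c a
    by (rule rtI) (simp add: power_mult_distrib rt)
  show "?rt 0 = 0" by (rule rtI) (use assms in simp)
  show "?rt 1 = 1" by (rule rtI) simp
qed

lemma inj_scale_exponent_add: "0 < q \<Longrightarrow> inj (\<lambda>w. scale_exponent q w + u)"
proof (rule injI, rule poly_mapping_eqI)
  fix w w' i
  assume "0 < q" "scale_exponent q w + u = scale_exponent q w' + u"
  then have "lookup (scale_exponent q w) i = lookup (scale_exponent q w') i" by simp
  then show "lookup w i = lookup w' i" using \<open>0 < q\<close> by simp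
qed

text \<open>The slope bound on \<open>v\<close> is what lets the trace-like map
  \<open>x^(q w + (q - 1) v) \<mapsto> x^w\<close> preserve the ring: rounding can only lose
  a slope of \<open>(q - 1) / q\<close>.\<close>
lemma scale_exponent_split:
  fixes P :: "'a set"
  assumes P: "finite_poset P le" and "0 < q"
    and v: "\<And>X Y. covers (ext_carrier P) (ext_le le) X Y \<Longrightarrow> ev v X \<le> ev v Y + 1"
      "v \<in> cone P le"
    and t: "t \<in> cone P le" and h: "h \<in> cone P le"
    and eq: "scale_exponent q w + scale_exponent (q - 1) v = scale_exponent q h + t"
  shows "\<exists>w'\<in>cone P le. w = h + w'"
proof -
  interpret E: finite_poset "ext_carrier P" "ext_le le" using P by (rule finite_poset_ext)
  have evq: "q * ev w X + (q - 1) * ev v X = q * ev h X + ev t X" for X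
    using arg_cong[OF eq, of "\<lambda>z. ev z X"] by simp
  \<comment> \<open>Integer values, since \<open>h \<le> w\<close> is not yet known; it follows
    later from antitonicity and the value 0 at the top.\<close>
  define f where "f X = int (ev w X) - int (ev h X)" for X
  have cov: "f Y \<le> f X" if XY: "covers (ext_carrier P) (ext_le le) X Y" for X Y
  proof -
    define s where "s = ev v X - ev v Y"
    have s: "ev v X = ev v Y + s" "s \<le> 1"
      using v(1)[OF XY] cone_covers[OF v(2) XY] by (auto simp: s_def)
    have "q * ev w Y + (q - 1) * ev v Y + q * ev h X \<le> q * ev w X + (q - 1) * ev v X + q * ev h Y"
      using evq[of X] evq[of Y] cone_covers[OF t XY] by linarith
    then have "q * (ev w Y + ev h X) \<le> q * (ev w X + ev h Y) + (q - 1) * s"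
      unfolding s(1) by (simp add: algebra_simps)
    then have "ev w Y + ev h X \<le> ev w X + ev h Y"
      using s(2) \<open>0 < q\<close> by (rule nat_le_of_mult_le)
    then show ?thesis by (simp add: f_def)
  qed
  have anti: "f Y \<le> f X" if "X \<in> ext_carrier P" "Y \<in> ext_carrier P" "ext_le le X Y" for X Y
    using E.antitone_if_covers[of f, OF cov] that by blast
  have nonneg: "ev h X \<le> ev w X" if "X \<in> ext_carrier P" for X
    using anti[OF that, of PosInf] by (simp add: f_def)
  have le: "lookup h i \<le> lookup w i" for i
    using nonneg[of NegInf] nonneg[of "Fin (the i)"] lookup_cone_eq_0[OF h, of i]
    by (cases i; cases "the i \<in> P") (auto simp: image_iff)
  have w: "w = h + (w - h)"
    by (rule poly_mapping_eqI) (simp add: lookup_add lookup_minus le)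
  have ev: "int (ev (w - h) X) = f X" for X
    using arg_cong[OF w, of "\<lambda>z. ev z X"] by (simp add: f_def)
  have "ev (w - h) Y \<le> ev (w - h) X"
    if "X \<in> ext_carrier P" "Y \<in> ext_carrier P" "ext_le le X Y" for X Y
    using anti[OF that] ev by (metis of_nat_le_iff)
  moreover have "i \<in> insert None (Some ` P)" if "i \<in> keys (w - h)" for i
  proof (rule ccontr)
    assume i: "i \<notin> insert None (Some ` P)"
    then have "q * lookup w i = 0"
      using arg_cong[OF eq, of "\<lambda>z. lookup z i"] lookup_cone_eq_0[OF _ i]
        v(2) t h by (simp add: lookup_add)
    then show False using that \<open>0 < q\<close> by (simp add: in_keys_iff lookup_minus)
  qed
  ultimately have "w - h \<in> cone P le" by (auto simp: cone_def)
  then show ?thesis using w by blast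
qed

lemma frob_splits_single:
  fixes P :: "'a set"
  assumes k: "CHAR('k::field) > 0" "perfect_field TYPE('k)" and P: "finite_poset P le"
    and v: "v \<in> cone P le" "\<And>X Y. covers (ext_carrier P) (ext_le le) X Y \<Longrightarrow> ev v X \<le> ev v Y + 1"
  shows "frob_splits P le (CHAR('k) ^ e)
    (Poly_Mapping.single (scale_exponent (CHAR('k) ^ e - 1) v) 1 :: ('a, 'k) hpoly)"
proof -
  interpret finite_poset P le by fact
  define q where "q = CHAR('k) ^ e"
  define u where "u = scale_exponent (q - 1) v"
  have q: "0 < q" using k by (simp add: q_def)
  note split = scale_exponent_split[OF P q v(2,1), folded u_def]
  obtain rt :: "'k \<Rightarrow> 'k" where rt: "\<And>a b. rt (a + b) = rt a + rt b"
    "\<And>c a. rt (c ^ q * a) = c * rt a" "rt 0 = 0" "rt 1 = 1"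
    using frobenius_root[OF k, of e] unfolding q_def by blast
  \<comment> \<open>Keep the monomials x^(q w + u), send each to x^w with the q-th root of its
    coefficient, and kill all others.\<close>
  define \<phi> :: "('a, 'k) hpoly \<Rightarrow> ('a, 'k) hpoly" where
    "\<phi> f = Abs_poly_mapping (\<lambda>w. rt (lookup f (scale_exponent q w + u)))" for f
  have lookup_\<phi>: "lookup (\<phi> f) w = rt (lookup f (scale_exponent q w + u))" for f w
  proof -
    have "finite ((\<lambda>w. scale_exponent q w + u) -` keys f)"
      using inj_scale_exponent_add[OF q] by (intro finite_vimageI) auto
    then have "finite {w. rt (lookup f (scale_exponent q w + u)) \<noteq> 0}"
      by (rule rev_finite_subset) (auto simp: in_keys_iff rt(3))
    then show ?thesis by (simp add: \<phi>_def)
  qed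
  have \<phi>_add: "\<phi> (f + g) = \<phi> f + \<phi> g" for f g
    by (rule poly_mapping_eqI) (simp add: lookup_\<phi> lookup_add rt(1))
  have \<phi>_ring: "\<phi> f \<in> hibi_ring P le" if f: "f \<in> hibi_ring P le" for f
  proof -
    have "w \<in> cone P le" if "w \<in> keys (\<phi> f)" for w
    proof -
      have "scale_exponent q w + u \<in> keys f" using that rt(3) by (auto simp: in_keys_iff lookup_\<phi>)
      then have "scale_exponent q w + u \<in> cone P le" using f hibi_ring_iff_keys[OF finite_Q] by blast
      \<comment> \<open>The instance h = 0 of \<open>split\<close>, with the whole exponent as
        t.\<close>
      moreover have "scale_exponent q 0 + (scale_exponent q w + u) = scale_exponent q w + u"
        by (rule poly_mapping_eqI) (simp add: lookup_add)
      ultimately show ?thesis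
        using split[of "scale_exponent q w + u" 0 w] by auto
    qed
    then show ?thesis using hibi_ring_iff_keys[OF finite_Q] by blast
  qed
  have \<phi>_single: "\<phi> (Poly_Mapping.single h 1 ^ q * s) = Poly_Mapping.single h 1 * \<phi> s"
    if h: "h \<in> cone P le" and s: "s \<in> hibi_ring P le" for h s
  proof (rule poly_mapping_eqI)
    fix w
    let ?M = "Poly_Mapping.single (scale_exponent q h) 1 :: ('a, 'k) hpoly"
    have M: "Poly_Mapping.single h 1 ^ q = ?M" by (simp add: single_power)
    show "lookup (\<phi> (Poly_Mapping.single h 1 ^ q * s)) w = lookup (Poly_Mapping.single h 1 * \<phi> s) w"
    proof (cases "\<exists>w'. w = h + w'")
      case True
      then obtain w' where w': "w = h + w'" by blast
      have "scale_exponent q w + u = scale_exponent q h + (scale_exponent q w' + u)"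
        by (rule poly_mapping_eqI) (simp add: w' lookup_add algebra_simps)
      then show ?thesis
        unfolding M w' by (simp add: lookup_\<phi> lookup_single_mult_add)
    next
      case False
      then have "w \<notin> keys (Poly_Mapping.single h 1 * \<phi> s)" using keys_single_mult by blast
      \<comment> \<open>If x^(q h) divides x^(q w + u) in the ring, then x^h divides x^w; here the
        slope bound on \<open>v\<close> enters the linearity.\<close>
      moreover have "scale_exponent q w + u \<notin> keys (?M * s)"
      proof
        assume "scale_exponent q w + u \<in> keys (?M * s)"
        then obtain t where "t \<in> keys s" "scale_exponent q w + u = scale_exponent q h + t"
          using keys_single_mult by blast
        moreover have "t \<in> cone P le" using calculation(1) s hibi_ring_iff_keys[OF finite_Q] by blast
        ultimately show False using split[of t h w] h False by blast
      qed
      ultimately show ?thesis unfolding M by (simp add: lookup_\<phi> in_keys_iff rt(3))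
    qed
  qed
  \<comment> \<open>Induction on the generation of r: q-th powers are additive, and linearity in two
    factors composes, so only constants and monomial generators are computed.\<close>
  have "\<forall>s\<in>hibi_ring P le. \<phi> (r ^ q * s) = r * \<phi> s" if "r \<in> hibi_ring P le" for r
    using that
  proof induction
    case (const c)
    have "scale_exponent q 0 = (0 :: 'a option \<Rightarrow>\<^sub>0 nat)" by (rule poly_mapping_eqI) simp
    then show ?case
      by (auto simp: const_poly_def single_power lookup_\<phi> lookup_const_mult rt(2) intro!: poly_mapping_eqI)
  next
    case (gen I)
    then show ?case using \<phi>_single ideal_exponent_cone[OF finite_Q] by (simp add: hibi_gen_eq)
  next
    case (add x y)
    have "prime CHAR('k)" using k(1) by (rule prime_CHAR_semidom)
    then have "(x + y) ^ q = x ^ q + y ^ q"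
      by (intro freshmans_dream'[of q e]) (simp_all add: CHAR_poly_mapping q_def)
    then show ?case using add.IH by (simp add: distrib_right \<phi>_add)
  next
    case (mult x y)
    then show ?case
      by (simp add: power_mult_distrib mult.assoc hibi_ring.mult hibi_ring_power)
  qed
  moreover have "\<phi> (Poly_Mapping.single u 1) = 1"
  proof (rule poly_mapping_eqI)
    fix w :: "'a option \<Rightarrow>\<^sub>0 nat"
    have "scale_exponent q w = 0 \<longleftrightarrow> w = 0"
      using q by (auto simp: poly_mapping_eq_iff fun_eq_iff)
    then show "lookup (\<phi> (Poly_Mapping.single u 1)) w = lookup 1 w"
      by (auto simp: lookup_\<phi> lookup_single lookup_one when_def rt(3,4))
  qed
  ultimately show ?thesis
    unfolding frob_splits_def using \<phi>_ring \<phi>_add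
    by (intro exI[of _ \<phi>]) (auto simp: q_def u_def)
qed

text \<open>A monomial of slope at least \<open>q\<close> on the facet of the cover \<open>X\<close>, \<open>Y\<close> is divisible by a
  \<open>q\<close>-th power \<open>w\<close> of slope one on that facet, up to a \<open>q\<close>-th power \<open>g\<close> of slope zero.\<close>
lemma facet_shift:
  assumes P: "finite_poset P le"
    and XY: "covers (ext_carrier P) (ext_le le) X Y"
    and z: "z \<in> cone P le" "ev z Y + q \<le> ev z X"
  obtains g w z' where "g \<in> cone P le" "w \<in> cone P le" "z' \<in> cone P le"
    "ev g X = ev g Y" "ev w X = ev w Y + 1"
    "scale_exponent q g + z = scale_exponent q w + z'"
proof -
  interpret P: finite_poset P le by fact
  interpret E: finite_poset "ext_carrier P" "ext_le le" using P by (rule finite_poset_ext)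
  let ?E = "ext_carrier P" and ?le = "ext_le le"
  have X: "X \<in> ?E" "Y \<in> ?E" "?le X Y" "X \<noteq> Y" "\<not> ?le Y X"
    using XY E.le_antisym by (auto simp: covers_def lt_in_def)
  have XP: "X \<noteq> PosInf" using X by auto
  \<comment> \<open>The indicator of the ideal below X drops across the facet X, Y but also across
    every other pair leaving that ideal. \<open>g\<close> is chosen to drop across all those other
    pairs and stay level on X, Y; its condition \<open>Y \<noteq> PosInf\<close> keeps it 0 at the
    top.\<close>
  define w where "w A = (if ?le A X then 1 else 0 :: nat)" for A
  define g where "g A = (if ?le A X \<and> A \<noteq> X then 1 else 0 :: nat) + (if ?le A Y \<and> Y \<noteq> PosInf then 1 else 0)" for A
  have trans: "?le A C" if "?le A B" "?le B C" "A \<in> ?E" "B \<in> ?E" "C \<in> ?E" for A B C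
    using that E.le_trans by blast
  \<comment> \<open>\<open>main\<close> says that q g + z - q w is antitone, written without
    truncated subtraction.\<close>
  have w_anti: "w B \<le> w A" and g_anti: "g B \<le> g A"
    and main: "q * g B + ev z B + q * w A \<le> q * g A + ev z A + q * w B"
    if AB: "A \<in> ?E" "B \<in> ?E" "?le A B" for A B
  proof -
    note zz = cone_antitone[OF z(1) AB]
    have BX: "?le A X" if "?le B X" using trans AB that X by blast
    have BY: "?le A Y" if "?le B Y" using trans AB that X by blast
    have BX': "A \<noteq> X" if "?le B X" "B \<noteq> X" using E.le_antisym[of X B] AB that X by auto
    show "w B \<le> w A" using BX by (auto simp: w_def)
    show gg: "g B \<le> g A" using BX BY BX' by (auto simp: g_def)
    show "q * g B + ev z B + q * w A \<le> q * g A + ev z A + q * w B"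
    proof (cases "?le A X \<and> \<not> ?le B X")
      case False
      then have "q * w A = q * w B" using BX by (auto simp: w_def)
      then show ?thesis using zz mult_le_mono2[OF gg, of q] by linarith
    next
      case True
      then have wv: "w A = 1" "w B = 0" by (auto simp: w_def)
      show ?thesis
      proof (cases "g B + 1 \<le> g A")
        case True
        then have "q * (g B + 1) \<le> q * g A" by (intro mult_le_mono) auto
        then show ?thesis using zz wv by simp
      next
        \<comment> \<open>Only the pair X, Y remains, and there the slope of z supplies the missing
          q.\<close>
        case g: False
        have "A = X"
          using g True BY by (auto simp: g_def split: if_splits)
        have "B = Y"
        proof (rule ccontr)
          assume "B \<noteq> Y"
          have "lt_in ?le X B" using AB True \<open>A = X\<close> E.le_refl by (auto simp: lt_in_def)
          then have "\<not> ?le B Y" using XY AB \<open>B \<noteq> Y\<close> by (auto simp: covers_def lt_in_def)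
          then have "Y \<noteq> PosInf" by auto
          then show False using g \<open>\<not> ?le B Y\<close> \<open>A = X\<close> X True by (auto simp: g_def)
        qed
        have "q * w A = q" "q * w B = 0" using wv by simp_all
        moreover have "ev z B + q \<le> ev z A" using \<open>A = X\<close> \<open>B = Y\<close> z(2) by simp
        ultimately show ?thesis using mult_le_mono2[OF gg, of q] by linarith
      qed
    qed
  qed
  have zero: "w PosInf = 0" "g PosInf = 0"
    using XP by (cases X; cases Y; auto simp: w_def g_def)+
  have nonneg: "q * w A \<le> q * g A + ev z A" if "A \<in> ?E" for A
    using main[OF that, of PosInf] zero by simp
  obtain w' where w': "w' \<in> cone P le" "\<And>A. A \<in> ?E \<Longrightarrow> ev w' A = w A"
    using cone_of_fun[where h = w and le = le, OF P.finite_Q zero(1)] w_anti by blast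
  obtain g' where g': "g' \<in> cone P le" "\<And>A. A \<in> ?E \<Longrightarrow> ev g' A = g A"
    using cone_of_fun[where h = g and le = le, OF P.finite_Q zero(2)] g_anti by blast
  define h where "h A = q * g A + ev z A - q * w A" for A
  have "h PosInf = 0" using zero by (simp add: h_def)
  moreover have "h B \<le> h A" if "A \<in> ?E" "B \<in> ?E" "?le A B" for A B
    using main[OF that] nonneg that unfolding h_def by fastforce
  ultimately obtain z' where z': "z' \<in> cone P le" "\<And>A. A \<in> ?E \<Longrightarrow> ev z' A = h A"
    using cone_of_fun[OF P.finite_Q, of h le] by blast
  have "scale_exponent q g' + z = scale_exponent q w' + z'"
  proof (rule cone_eqI)
    fix A assume "A \<in> ?E"
    then show "ev (scale_exponent q g' + z) A = ev (scale_exponent q w' + z') A"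
      using nonneg[of A] by (simp add: g' w' z' h_def)
  qed (auto intro: cone_add cone_scale_exponent g' w' z' z)
  moreover have "ev g' X = ev g' Y" using g' X E.le_refl by (auto simp: g_def)
  moreover have "ev w' X = ev w' Y + 1" using w' X E.le_refl by (auto simp: w_def)
  ultimately show ?thesis using that w' g' z' by blast
qed

text \<open>Splitting \<open>\<phi> d = 1\<close> over the monomials of \<open>d\<close>, some term
  has an image with non-zero constant term; \<open>facet_shift\<close> shows that this monomial
  violates no slope bound.\<close>

lemma frob_splits_slope_less:
  assumes P: "finite_poset P le" and d: "d \<in> hibi_ring P le" and split: "frob_splits P le q d"
  shows "\<exists>z\<in>keys d. \<forall>X Y. covers (ext_carrier P) (ext_le le) X Y \<longrightarrow> ev z X < ev z Y + q"
proof -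
  interpret finite_poset P le by fact
  let ?m = "\<lambda>z. Poly_Mapping.single z (lookup d z)"
  obtain \<phi> :: "('a, 'b) hpoly \<Rightarrow> ('a, 'b) hpoly" where
    ring: "\<And>x. x \<in> hibi_ring P le \<Longrightarrow> \<phi> x \<in> hibi_ring P le" and
    add: "\<And>x y. x \<in> hibi_ring P le \<Longrightarrow> y \<in> hibi_ring P le \<Longrightarrow> \<phi> (x + y) = \<phi> x + \<phi> y" and
    lin: "\<And>r s. r \<in> hibi_ring P le \<Longrightarrow> s \<in> hibi_ring P le \<Longrightarrow> \<phi> (r ^ q * s) = r * \<phi> s" and
    one: "\<phi> d = 1"
    using split unfolding frob_splits_def by blast
  have zero: "\<phi> 0 = 0" using add[OF hibi_ring_zero hibi_ring_zero] by simp
  have cone: "z \<in> cone P le" if "z \<in> keys d" for z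
    using d that hibi_ring_iff_keys[OF finite_Q] by blast
  have sum: "\<phi> (sum f A) = (\<Sum>i\<in>A. \<phi> (f i))" if "\<And>i. i \<in> A \<Longrightarrow> f i \<in> hibi_ring P le"
    for f :: "('a option \<Rightarrow>\<^sub>0 nat) \<Rightarrow> ('a, 'b) hpoly" and A
    using that
    by (induction A rule: infinite_finite_induct) (auto simp: zero add hibi_ring_sum)
  have "(\<Sum>z\<in>keys d. \<phi> (?m z)) = \<phi> (\<Sum>z\<in>keys d. ?m z)"
    by (rule sum[symmetric]) (rule single_in_hibi_ring[OF finite_Q cone])
  also have "\<dots> = 1" by (simp add: sum_single_keys one)
  finally have "lookup (\<Sum>z\<in>keys d. \<phi> (?m z)) 0 = lookup 1 0" by simp
  then have "(\<Sum>z\<in>keys d. lookup (\<phi> (?m z)) 0) \<noteq> 0"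
    by (simp only: lookup_sum lookup_one_zero one_neq_zero not_False_eq_True)
  then obtain z where z: "z \<in> keys d" "lookup (\<phi> (?m z)) 0 \<noteq> 0"
    by (rule sum.not_neutral_contains_not_neutral)
  have "ev z X < ev z Y + q" if XY: "covers (ext_carrier P) (ext_le le) X Y" for X Y
  proof (rule ccontr)
    assume "\<not> ev z X < ev z Y + q"
    then obtain g w z' where g: "g \<in> cone P le" "w \<in> cone P le" "z' \<in> cone P le"
      "ev g X = ev g Y" "ev w X = ev w Y + 1"
      "scale_exponent q g + z = scale_exponent q w + z'"
      using facet_shift[OF P XY cone[OF z(1)], of q] by auto
    let ?s = "\<lambda>u. Poly_Mapping.single u 1 :: ('a, 'b) hpoly"
    let ?z' = "Poly_Mapping.single z' (lookup d z)"
    note R = single_in_hibi_ring[OF finite_Q]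
    have "?s g ^ q * ?m z = ?s w ^ q * ?z'"
      using g(6) by (simp add: single_power mult_single)
    then have eq: "?s g * \<phi> (?m z) = ?s w * \<phi> ?z'"
      using lin[OF R[OF g(1)] R[OF cone[OF z(1)]], of 1 "lookup d z"]
        lin[OF R[OF g(2)] R[OF g(3)], of 1 "lookup d z"] by simp
    \<comment> \<open>The constant term reappears at exponent g, so \<open>g = w + r\<close> with r
      in the cone. On the facet, g has slope 0 but w + r has slope at least 1.\<close>
    have "lookup (?s g * \<phi> (?m z)) (g + 0) = lookup (\<phi> (?m z)) 0"
      by (simp only: lookup_single_mult_add mult_1)
    then have "g \<in> keys (?s w * \<phi> ?z')" using z(2) eq by (simp add: in_keys_iff)
    then obtain r where r: "r \<in> keys (\<phi> ?z')" "g = w + r" using keys_single_mult by blast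
    then have "r \<in> cone P le" using ring[OF R[OF g(3)]] hibi_ring_iff_keys[OF finite_Q] by blast
    then show False using cone_covers[OF _ XY, of r] g(4,5) r(2) by simp
  qed
  then show ?thesis using z(1) by blast
qed

text \<open>Weak duality: along a walk the value falls by at most q - 1 on each upward step and
  never falls on a downward one.\<close>

lemma reach_bounds_degree:
  assumes "reach (ext_carrier P) (ext_le le) n X" "z \<in> cone P le"
    and "\<And>X Y. covers (ext_carrier P) (ext_le le) X Y \<Longrightarrow> ev z X < ev z Y + q"
  shows "lookup z None \<le> ev z X + n * (q - 1)"
  using assms(1)
proof induction
  case (reach_minimal X)
  then show ?case by simp
next
  case (reach_up n X Y)
  then show ?case using assms(3)[OF reach_up.hyps(2)] by simp
next
  case (reach_down n Y X)
  then show ?case using cone_covers[OF assms(2) reach_down.hyps(2)] by simp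
qed

lemma F_pure_pair_lower_rank:
  fixes P :: "'a set"
  assumes k: "CHAR('k::field) > 0" "perfect_field TYPE('k)" and P: "finite_poset P le"
  shows "F_pure_pair TYPE('k) P le (real (lower_rank (ext_carrier P) (ext_le le)))"
proof -
  interpret P: finite_poset P le by fact
  interpret E: finite_poset "ext_carrier P" "ext_le le" using P by (rule finite_poset_ext)
  let ?D = "lower_rank (ext_carrier P) (ext_le le)"
  have ne: "ext_carrier P \<noteq> {}" by (auto simp: ext_carrier_def)
  have D: "E.cost PosInf = ?D"
    using E.reach_lower_rank[OF ne] E.cost_le E.lower_rank_le[OF _ E.reach_cost, of PosInf]
    by (intro antisym) auto
  have D0: "E.cost NegInf = 0"
    using E.cost_le[OF reach_minimal, of NegInf] by simp
  \<comment> \<open>The reversed distance function. \<open>?D\<close> is the cost of the top and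
    bounds every cost, so the subtraction never truncates; the value is 0 at the top and
    \<open>?D\<close> at the bottom.\<close>
  obtain v where v: "v \<in> cone P le" "\<And>X. X \<in> ext_carrier P \<Longrightarrow> ev v X = ?D - E.cost X"
    by (rule cone_of_fun[OF P.finite_Q, of "\<lambda>X. ?D - E.cost X" le])
      (use D E.cost_mono in \<open>auto intro: diff_le_mono2\<close>)
  have slope: "ev v X \<le> ev v Y + 1" if "covers (ext_carrier P) (ext_le le) X Y" for X Y
    using E.cost_covers[OF that] that v(2)[of X] v(2)[of Y] by (auto simp: covers_def)
  have deg: "lookup (scale_exponent n v) None = n * ?D" for n
    using v(2)[of NegInf] D0 by simp
  show ?thesis
    unfolding F_pure_pair_def
  proof (rule exI[of _ 0], intro allI impI)
    fix e :: nat
    let ?q = "CHAR('k) ^ e"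
    have "real ?q - 1 = real (?q - 1)"
      using k(1) by (simp add: of_nat_diff)
    then have "real ?D * (real ?q - 1) = real ((?q - 1) * ?D)"
      by (simp only: of_nat_mult mult.commute)
    then have n: "nat \<lceil>real ?D * (real ?q - 1)\<rceil> = (?q - 1) * ?D"
      by (simp only: ceiling_of_nat nat_int)
    have "Poly_Mapping.single (scale_exponent (?q - 1) v) 1 \<in> max_ideal_pow P le ((?q - 1) * ?D)"
      using single_in_max_ideal_pow[OF P.finite_Q cone_scale_exponent[OF v(1)], of "?q - 1"]
      unfolding deg .
    then show "\<exists>d :: ('a, 'k) hpoly. d \<in> max_ideal_pow P le (nat \<lceil>real ?D * (real (CHAR('k) ^ e) - 1)\<rceil>) \<and> frob_splits P le ?q d"
      unfolding n using frob_splits_single[OF k P v(1) slope] by blast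
  qed
qed

lemma F_pure_pair_le_lower_rank:
  fixes P :: "'a set"
  assumes k: "CHAR('k::field) > 0" and P: "finite_poset P le" and F: "F_pure_pair TYPE('k) P le t"
  shows "t \<le> real (lower_rank (ext_carrier P) (ext_le le))"
proof -
  interpret P: finite_poset P le by fact
  interpret E: finite_poset "ext_carrier P" "ext_le le" using P by (rule finite_poset_ext)
  let ?D = "lower_rank (ext_carrier P) (ext_le le)"
  obtain e0 where e0: "\<And>e. e0 \<le> e \<Longrightarrow> \<exists>d :: ('a, 'k) hpoly.
      d \<in> max_ideal_pow P le (nat \<lceil>t * (real (CHAR('k) ^ e) - 1)\<rceil>) \<and> frob_splits P le (CHAR('k) ^ e) d"
    using F by (auto simp: F_pure_pair_def)
  \<comment> \<open>One exponent suffices for the bound; taking e at least 1 makes q - 1 positive,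
    so it can be cancelled at the end.\<close>
  define e where "e = max e0 1"
  let ?q = "CHAR('k) ^ e" and ?n = "nat \<lceil>t * (real (CHAR('k) ^ e) - 1)\<rceil>"
  obtain d :: "('a, 'k) hpoly" where d: "d \<in> max_ideal_pow P le ?n" "frob_splits P le ?q d"
    using e0[of e] by (auto simp: e_def)
  note keys = max_ideal_pow_keys[OF P.finite_Q d(1)]
  have "d \<in> hibi_ring P le" using keys hibi_ring_iff_keys[OF P.finite_Q] by blast
  then obtain z where z: "z \<in> keys d"
    "\<And>X Y. covers (ext_carrier P) (ext_le le) X Y \<Longrightarrow> ev z X < ev z Y + ?q"
    using frob_splits_slope_less[OF P _ d(2)] by blast
  have "ext_carrier P \<noteq> {}" by (auto simp: ext_carrier_def)
  then have "reach (ext_carrier P) (ext_le le) ?D PosInf" using E.reach_lower_rank by fastforce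
  from reach_bounds_degree[OF this conjunct1[OF keys[OF z(1)]] z(2)]
  have "lookup z None \<le> ?D * (?q - 1)" by simp
  then have "?n \<le> ?D * (?q - 1)" using keys[OF z(1)] by linarith
  then have "real ?n \<le> real (?D * (?q - 1))" by (rule of_nat_mono)
  with real_nat_ceiling_ge have "t * (real ?q - 1) \<le> real (?D * (?q - 1))" by (rule order_trans)
  also have "real (?D * (?q - 1)) = real ?D * (real ?q - 1)" using k by (simp add: of_nat_diff)
  finally have "t * (real ?q - 1) \<le> real ?D * (real ?q - 1)" .
  moreover have "1 < ?q"
  proof (rule one_less_power)
    show "1 < CHAR('k)" using k CHAR_not_1'[where 'a='k] by linarith
  qed (simp add: e_def)
  then have "0 < real ?q - 1" by linarith
  ultimately show ?thesis by (rule mult_right_le_imp_le)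
qed

theorem theorem3p9:
  fixes P :: "'a set" and le :: "'a \<Rightarrow> 'a \<Rightarrow> bool"
  assumes "CHAR('k::field) > 0"
    and "perfect_field TYPE('k)"
    and "finite P" and "P \<noteq> {}"
    and "partial_order_on_set P le"
  shows "fpt_max TYPE('k) P le = real (lower_rank (ext_carrier P) (ext_le le))
       \<and> lower_rank (ext_carrier P) (ext_le le) = lower_rank P le + 2
       \<and> fpt_max TYPE('k) P le \<in> \<nat>"
proof -
  have P: "finite_poset P le" using assms by unfold_locales
  have "fpt_max TYPE('k) P le = real (lower_rank (ext_carrier P) (ext_le le))"
    unfolding fpt_max_def
    \<comment> \<open>The supremum is attained, the pair being F-pure at the lower rank
      itself.\<close>
    by (rule cSup_eq_maximum)
      (auto intro: F_pure_pair_lower_rank F_pure_pair_le_lower_rank P assms)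
  then show ?thesis using lower_rank_ext[OF P assms(4)] by simp
qed

end
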